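(* Let $\mathcal{B}$ be a unital $C^*$-algebra with a faithful tracial state $\phi$, and let $A=(A_1,\dots,A_n)$ be a tuple of linearly independent elements of $\mathcal{B}$ with $P^c(A)\neq\emptyset$. If $q\in\partial P^c(A)$ (the topological boundary of $P^c(A)$ in $\mathbb{C}^n$) is $\phi$-singular, then $q\notin[P^c(A)]$, where $[P^c(A)]$ is the completion of $P^c(A)$ with respect to the metric $g_A$.
   Context: For $z\in\mathbb{C}^n$ let $A(z)=z_1A_1+\cdots+z_nA_n$; $P(A)=\{z\in\mathbb{C}^n: A(z)\text{ is not invertible in }\mathcal{B}\}$ and $P^c(A)=\mathbb{C}^n\setminus P(A)$ (an open set, so $\partial P^c(A)\subset P(A)$). A faithful tracial state is a positive linear functional $\phi$ with $\phi(I)=1$, $\phi(ab)=\phi(ba)$ for all $a,b$, and $\phi(a^*a)>0$ for $a\ne0$. The metric $g_A$ on $P^c(A)$ is the Hermitian metric with matrix $g_{ij}(z)=\phi\big((A^{-1}(z)A_j)^*A^{-1}(z)A_i\big)$. The length of a piecewise smooth path $\gamma=\{z(t):0\le t\le1\}$ in $P^c(A)$ is $L(\gamma)=\int_0^1\sqrt{\sum_{i,j}z_i'(t)g_{ij}(z(t))\overline{z_j'(t)}}\,dt$, and $\mathrm{dist}(p,q)=\inf_\gamma L(\gamma)$ over all such paths from $p$ to $q$ in $P^c(A)$ (with $\mathrm{dist}=\infty$ for points in different connected components). Fuglede–Kadison determinant: for $x\in\mathcal{B}$ let $|x|=\sqrt{x^*x}$ and let $\mu_{|x|}$ be the probability measure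 on $\sigma(|x|)$ with $\phi(f(|x|))=\int f\,d\mu_{|x|}$ for continuous $f$ (i.e. $\mu_{|x|}=\phi(E(\cdot))$ with $E$ the spectral measure of $|x|$). Then $\det x=\exp\left(\int_{\sigma(|x|)}\log\lambda\,d\mu_{|x|}(\lambda)\right)\in[0,\infty)$, with $\det x=0$ if the integral is $-\infty$. An element $x$ is $\phi$-singular if $\det x=0$; a point $q\in P(A)$ is $\phi$-singular if $A(q)$ is $\phi$-singular. A boundary point $q\in\partial P^c(A)$ is regarded as belonging to $[P^c(A)]$ if there is a sequence in $P^c(A)$ that is Cauchy with respect to $\mathrm{dist}$ and converges to $q$ in $\mathbb{C}^n$ (in the usual topology); $q\notin[P^c(A)]$ means no such sequence exists. *)

theory Defs
  imports "HOL-Probability.Probability" "HOL-Computational_Algebra.Polynomial"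
begin

(* A unital C*-algebra is a complex Banach algebra with an isometric involution.  The class
   real_normed_algebra_1 supplies norm 1 = 1, which excludes only the zero algebra; the zero
   algebra carries no functional with value 1 at its unit. *)
class cstar_algebra = real_normed_algebra_1 + banach +
  fixes scaleC :: "complex \<Rightarrow> 'a \<Rightarrow> 'a"  (infixr "*\<^sub>C" 75)
    and adj :: "'a \<Rightarrow> 'a"
  assumes scaleC_add_right: "c *\<^sub>C (x + y) = c *\<^sub>C x + c *\<^sub>C y"
    and scaleC_add_left: "(c + d) *\<^sub>C x = c *\<^sub>C x + d *\<^sub>C x"
    and scaleC_scaleC: "c *\<^sub>C (d *\<^sub>C x) = (c * d) *\<^sub>C x"
    and scaleC_of_real: "complex_of_real r *\<^sub>C x = r *\<^sub>R x"
    and mult_scaleC_left: "(c *\<^sub>C x) * y = c *\<^sub>C (x * y)"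
    and mult_scaleC_right: "x * (c *\<^sub>C y) = c *\<^sub>C (x * y)"
    and norm_scaleC: "norm (c *\<^sub>C x) = cmod c * norm x"
    and adj_add: "adj (x + y) = adj x + adj y"
    and adj_scaleC: "adj (c *\<^sub>C x) = cnj c *\<^sub>C adj x"
    and adj_mult: "adj (x * y) = adj y * adj x"
    and adj_adj: "adj (adj x) = x"
    and cstar_identity: "norm (adj x * x) = (norm x)\<^sup>2"

definition faithful_tracial_state :: "('a::cstar_algebra \<Rightarrow> complex) \<Rightarrow> bool" where
  "faithful_tracial_state \<phi> \<longleftrightarrow>
     (\<forall>a b. \<phi> (a + b) = \<phi> a + \<phi> b) \<and>
     (\<forall>c a. \<phi> (c *\<^sub>C a) = c * \<phi> a) \<and>
     (\<forall>a. \<phi> (adj a * a) \<in> \<real>\<^sub>\<ge>\<^sub>0) \<and>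
     \<phi> 1 = 1 \<and>
     (\<forall>a b. \<phi> (a * b) = \<phi> (b * a)) \<and>
     (\<forall>a. a \<noteq> 0 \<longrightarrow> 0 < Re (\<phi> (adj a * a)))"


definition is_inverse_of :: "'a::cstar_algebra \<Rightarrow> 'a \<Rightarrow> bool" where
  "is_inverse_of b a \<longleftrightarrow> a * b = 1 \<and> b * a = 1"

definition alg_invertible :: "'a::cstar_algebra \<Rightarrow> bool" where
  "alg_invertible a \<longleftrightarrow> (\<exists>b. is_inverse_of b a)"

definition alg_inverse :: "'a::cstar_algebra \<Rightarrow> 'a" where
  "alg_inverse a = (THE b. is_inverse_of b a)"

definition spectrum :: "'a::cstar_algebra \<Rightarrow> complex set" where
  "spectrum a = {z. \<not> alg_invertible (a - z *\<^sub>C 1)}"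

(* For self-adjoint a the spectrum is real; real_spectrum is the same set inside the reals. *)
definition real_spectrum :: "'a::cstar_algebra \<Rightarrow> real set" where
  "real_spectrum a = {t. complex_of_real t \<in> spectrum a}"

definition positive_element :: "'a::cstar_algebra \<Rightarrow> bool" where
  "positive_element a \<longleftrightarrow> adj a = a \<and> spectrum a \<subseteq> \<real>\<^sub>\<ge>\<^sub>0"

definition alg_sqrt :: "'a::cstar_algebra \<Rightarrow> 'a" where
  "alg_sqrt a = (THE b. positive_element b \<and> b * b = a)"

definition alg_abs :: "'a::cstar_algebra \<Rightarrow> 'a" where
  "alg_abs x = alg_sqrt (adj x * x)"

definition poly_elem :: "complex poly \<Rightarrow> 'a::cstar_algebra \<Rightarrow> 'a" where
  "poly_elem p a = (\<Sum>k\<le>degree p. coeff p k *\<^sub>C a ^ k)"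

(* Continuous functional calculus f(a) for self-adjoint a and f continuous on its spectrum:
   the common limit of p_n(a) over all polynomial sequences p_n converging uniformly to f on
   the spectrum. *)
definition cfun_calc :: "(real \<Rightarrow> complex) \<Rightarrow> 'a::cstar_algebra \<Rightarrow> 'a" where
  "cfun_calc f a = (THE b. \<forall>p::nat \<Rightarrow> complex poly.
     uniform_limit (real_spectrum a) (\<lambda>n t. poly (p n) (complex_of_real t)) f sequentially \<longrightarrow>
     (\<lambda>n. poly_elem (p n) a) \<longlonglongrightarrow> b)"

(* Probability measures on the spectrum are represented as Borel probability measures on the
   reals that give the spectrum full measure. *)
definition is_spectral_distribution ::
    "('a::cstar_algebra \<Rightarrow> complex) \<Rightarrow> 'a \<Rightarrow> real measure \<Rightarrow> bool" where
  "is_spectral_distribution \<phi> a \<mu> \<longleftrightarrow>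
     real_distribution \<mu> \<and> measure \<mu> (real_spectrum a) = 1 \<and>
     (\<forall>f::real \<Rightarrow> complex. continuous_on (real_spectrum a) f \<longrightarrow>
        \<phi> (cfun_calc f a) = (LINT t:real_spectrum a|\<mu>. f t))"

definition spectral_distribution ::
    "('a::cstar_algebra \<Rightarrow> complex) \<Rightarrow> 'a \<Rightarrow> real measure" where
  "spectral_distribution \<phi> a = (THE \<mu>. is_spectral_distribution \<phi> a \<mu>)"

(* The library's ln 0 is 0, whereas the determinant needs log 0 = -\<infinity>.  Only t \<ge> 0 matters. *)
definition elog :: "real \<Rightarrow> ereal" where
  "elog t = (if t \<le> 0 then -\<infinity> else ereal (ln t))"

(* Positive part minus negative part: e2ennreal sends negative values to 0.  On the compact
   spectrum the positive part has finite integral, so \<infinity> - \<infinity> does not occur. *)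
definition log_integral :: "('a::cstar_algebra \<Rightarrow> complex) \<Rightarrow> 'a \<Rightarrow> ereal" where
  "log_integral \<phi> a =
     enn2ereal (\<integral>\<^sup>+t\<in>real_spectrum a. e2ennreal (elog t) \<partial>spectral_distribution \<phi> a) -
     enn2ereal (\<integral>\<^sup>+t\<in>real_spectrum a. e2ennreal (- elog t) \<partial>spectral_distribution \<phi> a)"

definition fk_det :: "('a::cstar_algebra \<Rightarrow> complex) \<Rightarrow> 'a \<Rightarrow> real" where
  "fk_det \<phi> x =
     (if log_integral \<phi> (alg_abs x) = -\<infinity> then 0
      else exp (real_of_ereal (log_integral \<phi> (alg_abs x))))"

definition phi_singular :: "('a::cstar_algebra \<Rightarrow> complex) \<Rightarrow> 'a \<Rightarrow> bool" where
  "phi_singular \<phi> x \<longleftrightarrow> fk_det \<phi> x = 0"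


definition pencil :: "'a::cstar_algebra ^ 'n \<Rightarrow> complex ^ 'n \<Rightarrow> 'a" where
  "pencil A z = (\<Sum>i\<in>UNIV. (z $ i) *\<^sub>C (A $ i))"

definition linearly_independent :: "'a::cstar_algebra ^ 'n \<Rightarrow> bool" where
  "linearly_independent A \<longleftrightarrow>
     (\<forall>c::complex ^ 'n. (\<Sum>i\<in>UNIV. (c $ i) *\<^sub>C (A $ i)) = 0 \<longrightarrow> (\<forall>i. c $ i = 0))"

definition proj_spectrum :: "'a::cstar_algebra ^ 'n \<Rightarrow> (complex ^ 'n) set" where
  "proj_spectrum A = {z. \<not> alg_invertible (pencil A z)}"

definition proj_resolvent :: "'a::cstar_algebra ^ 'n \<Rightarrow> (complex ^ 'n) set" where
  "proj_resolvent A = - proj_spectrum A"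

definition metric_coeff ::
    "('a::cstar_algebra \<Rightarrow> complex) \<Rightarrow> 'a ^ 'n \<Rightarrow> complex ^ 'n \<Rightarrow> 'n \<Rightarrow> 'n \<Rightarrow> complex" where
  "metric_coeff \<phi> A z i j =
     \<phi> (adj (alg_inverse (pencil A z) * A $ j) * (alg_inverse (pencil A z) * A $ i))"

(* Re only changes the type: the Hermitian form is real and nonnegative. *)
definition path_speed ::
    "('a::cstar_algebra \<Rightarrow> complex) \<Rightarrow> 'a ^ 'n \<Rightarrow> (real \<Rightarrow> complex ^ 'n) \<Rightarrow> real \<Rightarrow> real" where
  "path_speed \<phi> A \<gamma> t =
     (let v = vector_derivative \<gamma> (at t) in
      sqrt (Re (\<Sum>i\<in>UNIV. \<Sum>j\<in>UNIV. v $ i * metric_coeff \<phi> A (\<gamma> t) i j * cnj (v $ j))))"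

(* valid_path does not bound the derivative near the finitely many exceptional points, so the
   length is taken in [0,\<infinity>]; a path of infinite length does not affect the infimum below. *)
definition path_len ::
    "('a::cstar_algebra \<Rightarrow> complex) \<Rightarrow> 'a ^ 'n \<Rightarrow> (real \<Rightarrow> complex ^ 'n) \<Rightarrow> ennreal" where
  "path_len \<phi> A \<gamma> = (\<integral>\<^sup>+t\<in>{0..1}. ennreal (path_speed \<phi> A \<gamma> t) \<partial>lborel)"

(* The infimum of the empty set is \<infinity>, as wanted for points in different components. *)
definition path_dist ::
    "('a::cstar_algebra \<Rightarrow> complex) \<Rightarrow> 'a ^ 'n \<Rightarrow> complex ^ 'n \<Rightarrow> complex ^ 'n \<Rightarrow> ennreal" where
  "path_dist \<phi> A p q =
     (INF \<gamma>\<in>{\<gamma>. valid_path \<gamma> \<and> path_image \<gamma> \<subseteq> proj_resolvent A \<and>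
                pathstart \<gamma> = p \<and> pathfinish \<gamma> = q}. path_len \<phi> A \<gamma>)"

definition dist_Cauchy ::
    "('a::cstar_algebra \<Rightarrow> complex) \<Rightarrow> 'a ^ 'n \<Rightarrow> (nat \<Rightarrow> complex ^ 'n) \<Rightarrow> bool" where
  "dist_Cauchy \<phi> A u \<longleftrightarrow>
     (\<forall>e>0. \<exists>N. \<forall>k\<ge>N. \<forall>m\<ge>N. path_dist \<phi> A (u k) (u m) < ennreal e)"

(* The points of C^n that belong to the completion. *)
definition completion_points ::
    "('a::cstar_algebra \<Rightarrow> complex) \<Rightarrow> 'a ^ 'n \<Rightarrow> (complex ^ 'n) set" where
  "completion_points \<phi> A =
     {q. \<exists>u. (\<forall>k. u k \<in> proj_resolvent A) \<and> dist_Cauchy \<phi> A u \<and> u \<longlonglongrightarrow> q}"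

end

theory Submission
  imports Defs "HOL-Computational_Algebra.Fundamental_Theorem_Algebra"
begin

text \<open>Along a path \<open>x(t) = A(z(t))\<close> of invertible elements the logarithm of the Fuglede--Kadison determinant
  has derivative \<open>Re \<phi> (x\<^sup>-\<^sup>1 x')\<close>, which by Cauchy--Schwarz is at most the speed of the path. Hence
  \<open>log det\<close> varies by at most the distance and stays bounded below on a Cauchy sequence. It is upper
  semicontinuous, being the infimum over \<open>\<epsilon> > 0\<close> of the continuous functions \<open>\<phi> (log (x\<^sup>* x + \<epsilon>)) / 2\<close>,
  so it is bounded below at the limit point as well. The estimate is carried out for the smoothed functions
  directly, with the logarithm replaced by polynomials.\<close>

section \<open>Complex scalars and the involution\<close>

text \<open>The logarithm of an element that does not commute with its derivative is awkward to
  differentiate; for a polynomial the product rule and the trace property suffice. A polynomial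
  cannot approximate \<open>ln\<close> uniformly down to 0, and the spectrum of
  \<open>adj x * x\<close> may reach 0 at the limit point; the shift by \<epsilon> removes this
  obstacle. It does not spoil the constant: the derivative enters multiplied by \<open>s\<close>,
  and \<open>s / (s + \<epsilon>)\<close> is at most 1. So one lower bound is valid for all
  \<epsilon>, and Fatou's lemma carries it to the unsmoothed integral.

  Much of the development is forced by the definite descriptions behind \<open>cfun_calc\<close>,
  \<open>alg_sqrt\<close> and \<open>spectral_distribution\<close>, each of which must be shown to
  denote something. This calls for a spectral value of modulus \<open>norm a\<close> for
  self-adjoint \<open>a\<close>, for positivity of \<open>adj x * x\<close>, and for a measure
  representing the state.\<close>

lemma scaleC_1 [simp]: "1 *\<^sub>C (x::'a::cstar_algebra) = x"
  using scaleC_of_real[of 1 x] by simp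

lemma scaleC_of_real' [simp]: "complex_of_real r *\<^sub>C (x::'a::cstar_algebra) = r *\<^sub>R x"
  by (rule scaleC_of_real)

interpretation scaleC: bounded_bilinear "scaleC :: complex \<Rightarrow> 'a::cstar_algebra \<Rightarrow> 'a"
proof
  fix r :: real and c :: complex and x :: 'a
  show "(r *\<^sub>R c) *\<^sub>C x = r *\<^sub>R (c *\<^sub>C x)"
    by (simp add: scaleR_conv_of_real flip: scaleC_scaleC)
  show "c *\<^sub>C (r *\<^sub>R x) = r *\<^sub>R (c *\<^sub>C x)"
    by (simp add: scaleC_scaleC mult.commute flip: scaleC_of_real)
  show "\<exists>K. \<forall>c x. norm (c *\<^sub>C (x::'a)) \<le> norm c * norm x * K"
    by (rule exI[of _ 1]) (simp add: norm_scaleC)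
qed (simp_all add: scaleC_add_left scaleC_add_right)

lemmas [simp] = scaleC.zero_left scaleC.zero_right scaleC.minus_left scaleC.minus_right

lemma adj_scaleR: "adj (r *\<^sub>R (x::'a::cstar_algebra)) = r *\<^sub>R adj x"
  using adj_scaleC[of "complex_of_real r" x] by simp

lemma adj_0 [simp]: "adj (0::'a::cstar_algebra) = 0"
  using adj_scaleR[of 0 "0::'a"] by simp

lemma adj_1 [simp]: "adj (1::'a::cstar_algebra) = 1"
  by (metis adj_adj adj_mult mult.right_neutral mult_1)

lemma norm_adj [simp]: "norm (adj (x::'a::cstar_algebra)) = norm x"
proof -
  have le: "norm y \<le> norm (adj y)" for y :: 'a
  proof (cases "y = 0")
    case False
    have "norm y * norm y \<le> norm (adj y) * norm y"
      using cstar_identity[of y] norm_mult_ineq[of "adj y" y] by (simp add: power2_eq_square)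
    with False show ?thesis by simp
  qed simp
  show ?thesis using le[of x] le[of "adj x"] by (simp add: adj_adj)
qed

lemma bounded_linear_adj: "bounded_linear (adj :: 'a::cstar_algebra \<Rightarrow> 'a)"
  by (rule bounded_linear_intro[of _ 1]) (simp_all add: adj_add adj_scaleR)

lemmas adj_diff = bounded_linear.linear[OF bounded_linear_adj, THEN linear_diff]
lemmas adj_sum = bounded_linear.linear[OF bounded_linear_adj, THEN linear_sum]
lemmas tendsto_adj = bounded_linear.tendsto[OF bounded_linear_adj]

lemma adj_power: "adj ((x::'a::cstar_algebra) ^ n) = adj x ^ n"
  by (induction n) (simp_all add: adj_mult power_commutes)

section \<open>Invertible elements\<close>

lemma alg_invertibleI:
  assumes "a * b = 1" "c * a = (1::'a::cstar_algebra)"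
  shows "alg_invertible a"
proof -
  have "c = b" using assms by (metis mult.assoc mult.left_neutral mult.right_neutral)
  with assms show ?thesis by (auto simp: alg_invertible_def is_inverse_of_def)
qed

lemma is_inverse_of_unique:
  "is_inverse_of b a \<Longrightarrow> is_inverse_of c a \<Longrightarrow> b = (c::'a::cstar_algebra)"
  unfolding is_inverse_of_def by (metis mult.assoc mult.left_neutral mult.right_neutral)

lemma alg_inverse_eq: "is_inverse_of b a \<Longrightarrow> alg_inverse a = b"
  unfolding alg_inverse_def by (blast intro: is_inverse_of_unique)

lemma is_inverse_of_alg_inverse: "alg_invertible a \<Longrightarrow> is_inverse_of (alg_inverse a) a"
  using alg_inverse_eq unfolding alg_invertible_def by metis

lemma alg_inverse_right: "alg_invertible a \<Longrightarrow> a * alg_inverse a = 1"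
  and alg_inverse_left: "alg_invertible a \<Longrightarrow> alg_inverse a * a = 1"
  using is_inverse_of_alg_inverse by (auto simp: is_inverse_of_def)

lemma alg_invertible_1 [simp]: "alg_invertible (1::'a::cstar_algebra)"
  by (rule alg_invertibleI[of _ 1 1]) auto

lemma alg_invertible_mult:
  assumes "alg_invertible a" "alg_invertible (b::'a::cstar_algebra)"
  shows "alg_invertible (a * b)"
proof (rule alg_invertibleI)
  show "(a * b) * (alg_inverse b * alg_inverse a) = 1"
    using assms by (metis alg_inverse_right mult.assoc mult.right_neutral)
  show "(alg_inverse b * alg_inverse a) * (a * b) = 1"
    using assms by (metis alg_inverse_left mult.assoc mult.right_neutral)
qed

lemma alg_invertible_factor:
  assumes "a * b = b * a" "alg_invertible (a * b)"
  shows "alg_invertible (a::'a::cstar_algebra)"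
proof (rule alg_invertibleI)
  show "a * (b * alg_inverse (a * b)) = 1"
    using alg_inverse_right[OF assms(2)] by (simp add: mult.assoc)
  show "(alg_inverse (a * b) * b) * a = 1"
    using alg_inverse_left[OF assms(2)] assms(1) by (simp add: mult.assoc)
qed

lemma alg_invertible_scaleC_iff:
  assumes "c \<noteq> 0"
  shows "alg_invertible (c *\<^sub>C a) \<longleftrightarrow> alg_invertible (a::'a::cstar_algebra)"
proof -
  have imp: "alg_invertible (d *\<^sub>C b)" if "d \<noteq> 0" "alg_invertible b" for d and b :: 'a
    using that by (intro alg_invertibleI[of _ "inverse d *\<^sub>C alg_inverse b" "inverse d *\<^sub>C alg_inverse b"])
      (simp_all add: mult_scaleC_left mult_scaleC_right scaleC_scaleC alg_inverse_left alg_inverse_right)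
  show ?thesis
    using imp[of c a] imp[of "inverse c" "c *\<^sub>C a"] assms by (auto simp: scaleC_scaleC)
qed

lemma alg_invertible_adj:
  assumes "alg_invertible a"
  shows "alg_invertible (adj (a::'a::cstar_algebra))"
  by (rule alg_invertibleI[of _ "adj (alg_inverse a)" "adj (alg_inverse a)"])
    (simp_all add: alg_inverse_left alg_inverse_right assms flip: adj_mult)

text \<open>The third bound serves in two ways: it gives continuity of inversion, and in
  \<open>norm_in_spectrum\<close> it leads from an inverse close to 1 back to an element close to
  1.\<close>

lemma neumann_series:
  assumes "norm (x::'a::cstar_algebra) < 1"
  shows "alg_invertible (1 - x)"
    and "norm (alg_inverse (1 - x)) \<le> 1 / (1 - norm x)"
    and "norm (alg_inverse (1 - x) - 1) \<le> norm x / (1 - norm x)"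
proof -
  have sum_norm: "summable (\<lambda>n. norm (x ^ n))"
    by (rule summable_comparison_test'[of "\<lambda>n. norm x ^ n" 0])
      (use assms in \<open>auto simp: norm_power_ineq summable_geometric\<close>)
  then have sum: "summable (\<lambda>n. x ^ n)" by (rule summable_norm_cancel)
  define S where "S = (\<Sum>n. x ^ n)"
  have S: "S = 1 + (\<Sum>n. x ^ Suc n)"
    unfolding S_def using suminf_split_head[OF sum] by simp
  have shl: "(\<Sum>n. x ^ Suc n) = x * S" and shr: "(\<Sum>n. x ^ Suc n) = S * x"
    unfolding S_def using suminf_mult[OF sum, of x] suminf_mult2[OF sum, of x]
    by (simp_all add: power_commutes)
  have inv: "is_inverse_of S (1 - x)"
    unfolding is_inverse_of_def using S shl shr
    by (auto simp: left_diff_distrib right_diff_distrib)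
  then show "alg_invertible (1 - x)" by (auto simp: alg_invertible_def)
  have eq: "alg_inverse (1 - x) = S" by (rule alg_inverse_eq[OF inv])
  have "norm S \<le> (\<Sum>n. norm x ^ n)"
    unfolding S_def by (intro order.trans[OF summable_norm[OF sum_norm]] suminf_le)
      (use assms sum_norm in \<open>auto simp: norm_power_ineq summable_geometric\<close>)
  also have "\<dots> = 1 / (1 - norm x)" using assms by (simp add: suminf_geometric)
  finally show nS: "norm (alg_inverse (1 - x)) \<le> 1 / (1 - norm x)" by (simp add: eq)
  have "norm (S - 1) \<le> norm x * norm S" using S shl norm_mult_ineq[of x S] by simp
  also have "\<dots> \<le> norm x * (1 / (1 - norm x))" using nS by (intro mult_left_mono) (auto simp: eq)
  finally show "norm (alg_inverse (1 - x) - 1) \<le> norm x / (1 - norm x)" by (simp add: eq)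
qed

lemma alg_invertible_perturb:
  assumes a: "alg_invertible (a::'a::cstar_algebra)"
    and b: "norm (alg_inverse a) * norm (b - a) < 1"
  shows "alg_invertible b"
    and "norm (alg_inverse b - alg_inverse a) \<le>
      (norm (alg_inverse a) * norm (b - a)) / (1 - norm (alg_inverse a) * norm (b - a)) * norm (alg_inverse a)"
proof -
  let ?r = "norm (alg_inverse a) * norm (b - a)"
  define x where "x = alg_inverse a * (a - b)"
  have nx: "norm x \<le> ?r"
    unfolding x_def using norm_mult_ineq[of "alg_inverse a" "a - b"] by (simp add: norm_minus_commute)
  then have x1: "norm x < 1" using b by linarith
  have bx: "b = a * (1 - x)"
    unfolding x_def using alg_inverse_right[OF a]
    by (simp add: right_diff_distrib flip: mult.assoc)
  show inv: "alg_invertible b"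
    unfolding bx by (intro alg_invertible_mult a neumann_series x1)
  have "is_inverse_of (alg_inverse (1 - x) * alg_inverse a) b"
    unfolding is_inverse_of_def bx using neumann_series(1)[OF x1] a
    by (metis alg_inverse_left alg_inverse_right mult.assoc mult.right_neutral)
  then have "alg_inverse b - alg_inverse a = (alg_inverse (1 - x) - 1) * alg_inverse a"
    by (simp add: alg_inverse_eq left_diff_distrib)
  then have "norm (alg_inverse b - alg_inverse a) \<le> norm (alg_inverse (1 - x) - 1) * norm (alg_inverse a)"
    by (simp add: norm_mult_ineq)
  also have "norm (alg_inverse (1 - x) - 1) \<le> norm x / (1 - norm x)"
    by (rule neumann_series(3)[OF x1])
  also have "norm x / (1 - norm x) \<le> ?r / (1 - ?r)"
    using nx b by (intro frac_le) auto
  finally show "norm (alg_inverse b - alg_inverse a) \<le> ?r / (1 - ?r) * norm (alg_inverse a)"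
    by (simp add: mult_right_mono)
qed

lemma eventually_alg_invertible:
  assumes "alg_invertible (a::'a::cstar_algebra)"
  shows "\<forall>\<^sub>F b in nhds a. norm (alg_inverse a) * norm (b - a) < 1"
proof -
  have "((\<lambda>b. norm (alg_inverse a) * norm (b - a)) \<longlongrightarrow> norm (alg_inverse a) * norm (a - a)) (nhds a)"
    by (intro tendsto_intros filterlim_ident)
  then show ?thesis by (rule order_tendstoD) simp
qed

lemma open_alg_invertible: "open {a::'a::cstar_algebra. alg_invertible a}"
proof (subst open_subopen, safe)
  fix a :: 'a assume a: "alg_invertible a"
  show "\<exists>T. open T \<and> a \<in> T \<and> T \<subseteq> {a. alg_invertible a}"
    using eventually_alg_invertible[OF a] alg_invertible_perturb(1)[OF a]
    unfolding eventually_nhds by blast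
qed

lemma tendsto_alg_inverse:
  assumes a: "alg_invertible (a::'a::cstar_algebra)"
  shows "(alg_inverse \<longlongrightarrow> alg_inverse a) (nhds a)"
proof (rule LIM_zero_cancel, rule Lim_null_comparison)
  show "\<forall>\<^sub>F b in nhds a. norm (alg_inverse b - alg_inverse a) \<le>
      (norm (alg_inverse a) * norm (b - a)) / (1 - norm (alg_inverse a) * norm (b - a)) * norm (alg_inverse a)"
    using eventually_alg_invertible[OF a] by eventually_elim (rule alg_invertible_perturb(2)[OF a])
  have "((\<lambda>b. (norm (alg_inverse a) * norm (b - a)) / (1 - norm (alg_inverse a) * norm (b - a)) * norm (alg_inverse a))
     \<longlongrightarrow> (norm (alg_inverse a) * norm (a - a)) / (1 - norm (alg_inverse a) * norm (a - a)) * norm (alg_inverse a)) (nhds a)"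
    by (intro tendsto_intros filterlim_ident) auto
  then show "((\<lambda>b. (norm (alg_inverse a) * norm (b - a)) / (1 - norm (alg_inverse a) * norm (b - a)) * norm (alg_inverse a)) \<longlongrightarrow> 0) (nhds a)"
    by simp
qed

section \<open>Polynomials in an element\<close>

lemma poly_elem_upto:
  assumes "degree p \<le> n"
  shows "poly_elem p a = (\<Sum>k\<le>n. coeff p k *\<^sub>C a ^ k)"
  unfolding poly_elem_def
  by (rule sum.mono_neutral_left) (use assms in \<open>auto simp: coeff_eq_0\<close>)

lemma poly_elem_0 [simp]: "poly_elem 0 a = 0"
  by (simp add: poly_elem_def)

lemma poly_elem_pCons [simp]: "poly_elem (pCons c p) a = c *\<^sub>C 1 + a * poly_elem p a"
proof -
  have "poly_elem (pCons c p) a = (\<Sum>k\<le>Suc (degree p). coeff (pCons c p) k *\<^sub>C a ^ k)"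
    by (rule poly_elem_upto) (simp add: degree_pCons_le)
  also have "\<dots> = c *\<^sub>C 1 + (\<Sum>k\<le>degree p. coeff p k *\<^sub>C a ^ Suc k)"
    by (subst sum.atMost_Suc_shift) simp
  finally show ?thesis
    by (simp add: poly_elem_def sum_distrib_left mult_scaleC_right)
qed

lemma poly_elem_add: "poly_elem (p + q) a = poly_elem p a + poly_elem q a"
proof -
  let ?n = "max (degree p) (degree q)"
  have "degree (p + q) \<le> ?n" by (rule degree_add_le_max)
  then show ?thesis
    by (simp add: poly_elem_upto[of _ ?n] scaleC_add_left sum.distrib)
qed

lemma poly_elem_smult: "poly_elem (smult c p) a = c *\<^sub>C poly_elem p a"
  by (simp add: poly_elem_upto[of "smult c p" "degree p"] degree_smult_le poly_elem_def
      scaleC.sum_right scaleC_scaleC)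

lemma poly_elem_minus: "poly_elem (- p) a = - poly_elem p a"
  using poly_elem_smult[of "-1" p a] by (simp add: scaleC.minus_left)

lemma poly_elem_diff: "poly_elem (p - q) a = poly_elem p a - poly_elem q a"
  using poly_elem_add[of p "- q" a] by (simp add: poly_elem_minus)

lemma poly_elem_mult: "poly_elem (p * q) a = poly_elem p a * poly_elem q a"
  by (induction p)
    (simp_all add: poly_elem_add poly_elem_smult distrib_right mult_scaleC_left mult.assoc)

lemma poly_elem_pcompose: "poly_elem (pcompose p q) a = poly_elem p (poly_elem q a)"
  by (induction p) (simp_all add: pcompose_pCons poly_elem_add poly_elem_mult)

lemma poly_elem_commute: "poly_elem p a * poly_elem q a = poly_elem q a * poly_elem p a"
  by (simp add: mult.commute flip: poly_elem_mult)

lemma adj_poly_elem: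
  assumes "adj a = a"
  shows "adj (poly_elem p a) = poly_elem (map_poly cnj p) a"
  by (simp add: poly_elem_def adj_sum adj_scaleC adj_power assms coeff_map_poly degree_map_poly)

lemma adj_poly_elem_of_real:
  assumes "adj a = a"
  shows "adj (poly_elem (map_poly of_real p) a) = poly_elem (map_poly of_real (p::real poly)) a"
  by (simp add: adj_poly_elem[OF assms] map_poly_map_poly o_def)

lemma poly_cnj_of_real: "poly (map_poly cnj p) (of_real t) = cnj (poly p (of_real t))"
  by (metis complex_cnj_complex_of_real poly_cnj)

lemma tendsto_poly_elem:
  "((f :: _ \<Rightarrow> 'a::cstar_algebra) \<longlongrightarrow> l) F \<Longrightarrow> ((\<lambda>x. poly_elem p (f x)) \<longlongrightarrow> poly_elem p l) F"
  unfolding poly_elem_def by (intro tendsto_intros scaleC.tendsto)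

section \<open>The spectrum\<close>

text \<open>Splitting off one root at a time reduces the claim to linear factors: a root of
  \<open>p\<close> lies outside the spectrum, so its factor \<open>a - z\<close> is
  invertible.\<close>

lemma notin_spectrum_poly:
  assumes "p \<noteq> 0" and "\<And>z. z \<in> spectrum a \<Longrightarrow> poly p z \<noteq> 0"
  shows "alg_invertible (poly_elem p a)"
  using assms
proof (induction "degree p" arbitrary: p)
  case 0
  then obtain c where "p = [:c:]" "c \<noteq> 0" by (metis degree_eq_zeroE pCons_0_0)
  then show ?case by (simp add: alg_invertible_scaleC_iff)
next
  case (Suc n)
  have "\<not> constant (poly p)" using Suc.hyps(2) by (simp add: constant_degree)
  then obtain z where z: "poly p z = 0" using fundamental_theorem_of_algebra by blast
  then obtain r where r: "p = [:- z, 1:] * r" by (metis dvdE poly_eq_0_iff_dvd)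
  have "r \<noteq> 0" using Suc.prems(1) r by auto
  moreover have "degree r = n"
    using Suc.hyps(2) \<open>r \<noteq> 0\<close> by (simp add: r degree_mult_eq del: mult_pCons_left)
  moreover have "poly r w \<noteq> 0" if "w \<in> spectrum a" for w
    using Suc.prems(2)[OF that] by (auto simp: r)
  ultimately have "alg_invertible (poly_elem r a)" using Suc.hyps(1) by blast
  moreover have "alg_invertible (poly_elem [:- z, 1:] a)"
    using Suc.prems(2)[of z] z by (auto simp: spectrum_def scaleC.minus_left)
  ultimately show ?case
    unfolding r poly_elem_mult by (rule alg_invertible_mult[rotated])
qed

text \<open>\<open>p\<close> minus its value at \<open>z\<close> is divisible by the linear factor
  at \<open>z\<close>. The two factors commute, so invertibility of the product would pass to
  \<open>a - z\<close>.\<close>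

lemma poly_in_spectrum:
  assumes "z \<in> spectrum a"
  shows "poly p z \<in> spectrum (poly_elem p a)"
proof -
  obtain r where r: "p - [:poly p z:] = [:- z, 1:] * r"
    by (metis dvdE poly_eq_0_iff_dvd poly_diff poly_pCons mult_zero_right poly_0 add.right_neutral cancel_comm_monoid_add_class.diff_cancel)
  have "poly_elem p a - poly p z *\<^sub>C 1 = poly_elem (p - [:poly p z:]) a"
    by (simp add: poly_elem_diff)
  also have "\<dots> = poly_elem [:- z, 1:] a * poly_elem r a"
    by (simp add: r poly_elem_mult del: mult_pCons_left)
  finally have eq: "poly_elem p a - poly p z *\<^sub>C 1 = poly_elem [:- z, 1:] a * poly_elem r a" .
  have "\<not> alg_invertible (poly_elem [:- z, 1:] a)"
    using assms by (simp add: spectrum_def scaleC.minus_left)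
  then show ?thesis
    using alg_invertible_factor poly_elem_commute unfolding spectrum_def mem_Collect_eq eq by blast
qed

lemma norm_spectrum_le:
  assumes "z \<in> spectrum a"
  shows "cmod z \<le> norm (a::'a::cstar_algebra)"
proof (rule ccontr)
  assume "\<not> ?thesis"
  then have gt: "norm a < cmod z" by simp
  then have z: "z \<noteq> 0" by auto
  have "norm (inverse z *\<^sub>C a) < 1"
    using gt z by (simp add: norm_scaleC norm_inverse field_simps norm_divide)
  then have "alg_invertible (1 - inverse z *\<^sub>C a)" by (rule neumann_series)
  then have "alg_invertible ((- z) *\<^sub>C (1 - inverse z *\<^sub>C a))"
    using z by (simp add: alg_invertible_scaleC_iff del: scaleC.minus_left)
  also have "(- z) *\<^sub>C (1 - inverse z *\<^sub>C a) = a - z *\<^sub>C 1"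
    using z by (simp add: scaleC.diff_right scaleC_scaleC scaleC.minus_left)
  finally show False using assms by (simp add: spectrum_def)
qed

lemma closed_spectrum: "closed (spectrum (a::'a::cstar_algebra))"
proof -
  have "open ((\<lambda>z. a - z *\<^sub>C 1) -` {b. alg_invertible b})"
    by (intro open_vimage open_alg_invertible continuous_intros scaleC.continuous_on)
  then show ?thesis
    by (simp add: closed_def spectrum_def Collect_neg_eq vimage_def)
qed

text \<open>Arens' trick: shift \<open>a\<close> by an imaginary scalar \<open>s\<close>. The
  C*-identity bounds the squared norm of the shifted element by
  \<open>(norm a)\<^sup>2 + s\<^sup>2\<close>, whereas the shifted spectral value has a cross term
  linear in \<open>s\<close>. Since \<open>s\<close> is arbitrary, \<open>Im z\<close> must
  vanish.\<close>

lemma spectrum_self_adjoint: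
  assumes a: "adj a = (a::'a::cstar_algebra)" and z: "z \<in> spectrum a"
  shows "z \<in> \<real>"
proof -
  have key: "2 * Im z * s \<le> (norm a)\<^sup>2" for s :: real
  proof -
    let ?b = "a + (\<i> * of_real s) *\<^sub>C 1"
    have "poly [:\<i> * of_real s, 1:] z \<in> spectrum (poly_elem [:\<i> * of_real s, 1:] a)"
      by (rule poly_in_spectrum[OF z])
    then have "\<i> * of_real s + z \<in> spectrum ?b" by (simp add: add.commute)
    then have "cmod (\<i> * of_real s + z) \<le> norm ?b" by (rule norm_spectrum_le)
    then have "(cmod (\<i> * of_real s + z))\<^sup>2 \<le> (norm ?b)\<^sup>2" by (simp add: power_mono)
    also have "(norm ?b)\<^sup>2 = norm (adj ?b * ?b)" by (simp add: cstar_identity)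
    also have "adj ?b * ?b = a * a + s\<^sup>2 *\<^sub>R 1"
    proof -
      have "adj ?b = a - (\<i> * of_real s) *\<^sub>C 1"
        by (simp add: adj_add adj_scaleC a scaleC.minus_left)
      then have "adj ?b * ?b = (a - (\<i> * of_real s) *\<^sub>C 1) * ?b" by (rule arg_cong)
      also have "\<dots> = a * a - ((\<i> * of_real s) * (\<i> * of_real s)) *\<^sub>C 1"
        by (simp add: algebra_simps mult_scaleC_left mult_scaleC_right scaleC_scaleC scaleC.diff_right)
      also have "(\<i> * of_real s) * (\<i> * of_real s) = complex_of_real (- s\<^sup>2)"
        by (simp add: power2_eq_square algebra_simps)
      finally show ?thesis by (simp only: scaleC_of_real) simp
    qed
    also have "norm (a * a + s\<^sup>2 *\<^sub>R 1) \<le> norm (a * a) + s\<^sup>2"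
      by (rule order.trans[OF norm_triangle_ineq]) simp
    also have "norm (a * a) \<le> (norm a)\<^sup>2"
      by (simp add: norm_mult_ineq power2_eq_square)
    finally have "(Re z)\<^sup>2 + (s + Im z)\<^sup>2 \<le> (norm a)\<^sup>2 + s\<^sup>2"
      by (simp add: cmod_power2)
    then show ?thesis
      by (smt (verit, best) power2_sum zero_le_power2 mult.commute mult.left_commute)
  qed
  have "Im z = 0"
  proof (rule ccontr)
    assume "Im z \<noteq> 0"
    then have "2 * Im z * (((norm a)\<^sup>2 + 1) / (2 * Im z)) = (norm a)\<^sup>2 + 1" by simp
    with key[of "((norm a)\<^sup>2 + 1) / (2 * Im z)"] show False by linarith
  qed
  then show ?thesis by (simp add: complex_is_Real_iff)
qed

section \<open>Norm and spectral radius\<close>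

lemma one_minus_power_factor:
  fixes y :: "'a::ring_1"
  shows "(1 - y) * (\<Sum>m<n. y ^ m) = 1 - y ^ n" and "(\<Sum>m<n. y ^ m) * (1 - y) = 1 - y ^ n"
proof -
  show "(1 - y) * (\<Sum>m<n. y ^ m) = 1 - y ^ n"
    by (induction n) (simp_all add: distrib_left left_diff_distrib)
  show "(\<Sum>m<n. y ^ m) * (1 - y) = 1 - y ^ n"
    by (induction n) (simp_all add: distrib_right right_diff_distrib power_commutes, simp add: algebra_simps)
qed

lemma sum_powers_root_of_unity:
  assumes "m < n"
  shows "(\<Sum>k<n. cis (2 * pi / n) ^ (k * m)) = (if m = 0 then of_nat n else 0)"
proof (cases "m = 0")
  case False
  let ?w = "cis (2 * pi * m / n)"
  have "?w \<noteq> 1"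
  proof
    assume "?w = 1"
    then have "cos (2 * pi * m / n) = 1" by (simp add: complex_eq_iff)
    then obtain i :: int where "2 * pi * m / n = of_int i * 2 * pi"
      using cos_one_2pi_int by blast
    then have "real m = of_int i * real n" using assms by (simp add: field_simps)
    then have "int m = i * int n" by (metis of_int_eq_iff of_int_mult of_int_of_nat_eq)
    moreover have "0 < int m" "int m < int n" using False assms by auto
    ultimately show False by (metis dvd_triv_right zdvd_not_zless)
  qed
  have "(\<Sum>k<n. cis (2 * pi / n) ^ (k * m)) = (\<Sum>k<n. ?w ^ k)"
    by (simp add: Complex.DeMoivre mult_ac)
  also have "\<dots> = (?w ^ n - 1) / (?w - 1)" by (rule geometric_sum[OF \<open>?w \<noteq> 1\<close>])
  also have "?w ^ n = 1"
    using assms using cis_multiple_2pi[of "real m"] by (simp add: Complex.DeMoivre mult_ac)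
  finally show ?thesis using False by simp
qed simp

text \<open>The partial fraction decomposition of \<open>1 / (1 - t\<^sup>n)\<close>. It turns the uniform continuity of
  the resolvent on a disc into a bound that does not depend on \<open>n\<close>.\<close>

lemma inverse_one_minus_power:
  fixes x :: "'a::cstar_algebra"
  assumes n: "n > 0" and inv: "\<And>z. cmod z = 1 \<Longrightarrow> alg_invertible (1 - z *\<^sub>C x)"
  shows "alg_invertible (1 - x ^ n)"
    and "alg_inverse (1 - x ^ n) = (1 / n) *\<^sub>R (\<Sum>k<n. alg_inverse (1 - cis (2 * pi / n) ^ k *\<^sub>C x))"
proof -
  let ?w = "cis (2 * pi / n)"
  let ?R = "\<lambda>k. alg_inverse (1 - ?w ^ k *\<^sub>C x)"
  let ?G = "\<lambda>k. \<Sum>m<n. (?w ^ k *\<^sub>C x) ^ m"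
  have pow: "(c *\<^sub>C x) ^ m = c ^ m *\<^sub>C x ^ m" for c m
    by (induction m) (simp_all add: mult_scaleC_left mult_scaleC_right scaleC_scaleC mult_ac)
  have wn: "(?w ^ k *\<^sub>C x) ^ n = x ^ n" for k
  proof -
    have "?w ^ n = 1" using n by (simp add: Complex.DeMoivre)
    then have "(?w ^ k) ^ n = 1" by (metis power_mult mult.commute power_one)
    then show ?thesis by (simp add: pow)
  qed
  have invk: "alg_invertible (1 - ?w ^ k *\<^sub>C x)" for k
    by (rule inv) (simp add: norm_power)
  have left: "?R k * (1 - x ^ n) = ?G k" for k
    unfolding wn[of k, symmetric] one_minus_power_factor(1)[symmetric] mult.assoc[symmetric]
      alg_inverse_left[OF invk] by simp
  have right: "(1 - x ^ n) * ?R k = ?G k" for k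
    unfolding wn[of k, symmetric] one_minus_power_factor(2)[symmetric] mult.assoc
      alg_inverse_right[OF invk] by simp
  \<comment> \<open>Orthogonality of the roots of unity: summing over \<open>k\<close> cancels every
    power of \<open>x\<close> below \<open>n\<close> except the zeroth.\<close>
  have "(\<Sum>k<n. ?G k) = (\<Sum>m<n. \<Sum>k<n. ?w ^ (k * m) *\<^sub>C x ^ m)"
    by (subst sum.swap) (simp add: pow power_mult)
  also have "\<dots> = (\<Sum>m<n. (if m = 0 then of_nat n else 0) *\<^sub>C x ^ m)"
    by (intro sum.cong refl) (simp only: sum_powers_root_of_unity lessThan_iff flip: scaleC.sum_left)
  also have "\<dots> = (\<Sum>m<n. if m = 0 then real n *\<^sub>R 1 else 0)"
    by (intro sum.cong refl) (simp flip: scaleC_of_real)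
  also have "\<dots> = real n *\<^sub>R 1" using n by simp
  finally have G: "(\<Sum>k<n. ?G k) = real n *\<^sub>R 1" .
  have "is_inverse_of ((1 / n) *\<^sub>R (\<Sum>k<n. ?R k)) (1 - x ^ n)"
    unfolding is_inverse_of_def using n
    by (simp only: mult_scaleR_left mult_scaleR_right sum_distrib_left sum_distrib_right left right G) simp
  then show "alg_invertible (1 - x ^ n)" "alg_inverse (1 - x ^ n) = (1 / n) *\<^sub>R (\<Sum>k<n. ?R k)"
    by (auto simp: alg_invertible_def alg_inverse_eq)
qed

text \<open>Each squaring is an instance of the C*-identity, because powers of \<open>x\<close> are
  again self-adjoint. Hence the exponents are powers of 2.\<close>

lemma norm_self_adjoint_power_two:
  assumes "adj x = (x::'a::cstar_algebra)"
  shows "norm (x ^ (2 ^ k)) = norm x ^ (2 ^ k)"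
proof (induction k)
  case (Suc k)
  have "x ^ (2 ^ Suc k) = adj (x ^ (2 ^ k)) * x ^ (2 ^ k)"
    by (simp only: adj_power assms power_Suc mult_2 power_add)
  then have "norm (x ^ (2 ^ Suc k)) = (norm (x ^ (2 ^ k)))\<^sup>2"
    by (simp only: cstar_identity)
  also have "\<dots> = norm x ^ (2 ^ k * 2)" by (simp only: Suc.IH power_mult)
  finally show ?case by (simp add: mult.commute)
qed simp

text \<open>An argument without holomorphic functions. If no spectral value had modulus
  \<open>norm a\<close>, the normalised element \<open>x\<close> would have a resolvent
  \<open>R\<close> that is uniformly continuous on the closed unit disc. Averaging over roots of
  unity then makes the inverses of \<open>1 - (s *\<^sub>R x) ^ n\<close> and
  \<open>1 - x ^ n\<close> close, uniformly in \<open>n\<close>, for some \<open>s < 1\<close>. The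
  former is near 1 for large \<open>n\<close>, so \<open>x ^ n\<close> would be small, although its
  norm is 1 whenever \<open>n\<close> is a power of 2.\<close>

lemma norm_in_spectrum:
  assumes a: "adj a = (a::'a::cstar_algebra)"
  obtains z where "z \<in> spectrum a" "cmod z = norm a"
proof (cases "a = 0")
  case True
  then have "0 \<in> spectrum a" by (auto simp: spectrum_def alg_invertible_def is_inverse_of_def)
  with True show ?thesis by (intro that[of 0]) auto
next
  case False
  note witness = that
  show thesis
  proof (rule ccontr)
    assume "\<not> thesis"
    have none: "z \<notin> spectrum a" if "cmod z = norm a" for z
      using \<open>\<not> thesis\<close> that witness by blast
    define x where "x = inverse (norm a) *\<^sub>R a"
    have x: "adj x = x" "norm x = 1" "a = norm a *\<^sub>R x"
      using False by (simp_all add: x_def adj_scaleR a)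
    have inv: "alg_invertible (1 - z *\<^sub>C x)" if z: "cmod z \<le> 1" for z
    proof (cases "cmod z = 1")
      case True
      then have z0: "z \<noteq> 0" by auto
      have "of_real (norm a) / z \<notin> spectrum a"
        by (rule none) (simp add: norm_divide True)
      then have "alg_invertible (a - (of_real (norm a) / z) *\<^sub>C 1)" by (simp add: spectrum_def)
      then have "alg_invertible ((- z / of_real (norm a)) *\<^sub>C (a - (of_real (norm a) / z) *\<^sub>C 1))"
        using z0 False by (subst alg_invertible_scaleC_iff) auto
      also have "(- z / of_real (norm a)) *\<^sub>C (a - (of_real (norm a) / z) *\<^sub>C 1) = 1 - z *\<^sub>C x"
        using z0 False
        by (simp add: scaleC.diff_right scaleC_scaleC x_def divide_inverse flip: scaleC_of_real) (simp add: field_simps)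
      finally show ?thesis .
    qed (use z x in \<open>auto intro!: neumann_series(1) simp: norm_scaleC\<close>)
    define R where "R z = alg_inverse (1 - z *\<^sub>C x)" for z
    have "continuous_on (cball 0 1) R"
    proof (rule continuous_on_eq_continuous_within[THEN iffD2], safe)
      fix z :: complex assume "z \<in> cball 0 1"
      then have "alg_invertible (1 - z *\<^sub>C x)" by (intro inv) auto
      from tendsto_alg_inverse[OF this]
      have "((\<lambda>y. alg_inverse (1 - y *\<^sub>C x)) \<longlongrightarrow> alg_inverse (1 - z *\<^sub>C x)) (at z within cball 0 1)"
        by (rule filterlim_compose) (intro tendsto_intros scaleC.tendsto)
      then show "continuous (at z within cball 0 1) R" by (simp add: continuous_within R_def[abs_def])
    qed
    then have "uniformly_continuous_on (cball 0 1) R"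
      by (rule compact_uniformly_continuous) simp
    \<comment> \<open>The constants fit together as follows: 1/6 here, and 1/6 = (1/7) / (1 - 1/7)
      from the Neumann bound for \<open>s *\<^sub>R x\<close>, add up to 1/3, and (1/3) / (1 - 1/3)
      = 1/2 < 1.\<close>
    then obtain d where d: "d > 0"
      and uc: "\<And>y z. y \<in> cball 0 1 \<Longrightarrow> z \<in> cball 0 1 \<Longrightarrow> dist y z < d \<Longrightarrow> dist (R y) (R z) < 1/6"
      unfolding uniformly_continuous_on_def by (meson zero_less_divide_1_iff zero_less_numeral)
    define s where "s = max (1/2) (1 - d/2)"
    have s: "0 < s" "s < 1" "1 - s < d" using d by (auto simp: s_def)
    obtain k where k: "s ^ k < 1/7" using real_arch_pow_inv[of "1/7" s] s by auto
    define n :: nat where "n = 2 ^ k"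
    have n: "n > 0" by (simp add: n_def)
    have sn: "s ^ n \<le> 1/7"
      using power_decreasing[of k "2 ^ k" s] less_imp_le[OF less_exp[of k]] s k
      unfolding n_def by linarith
    have inv1: "alg_invertible (1 - z *\<^sub>C x)" if "cmod z = 1" for z using inv that by simp
    have invs: "alg_invertible (1 - z *\<^sub>C (s *\<^sub>R x))" if "cmod z = 1" for z
      using inv[of "z * of_real s"] that s by (simp add: norm_mult flip: scaleC_scaleC)
    have "alg_inverse (1 - (s *\<^sub>R x) ^ n) - alg_inverse (1 - x ^ n) =
        (1 / n) *\<^sub>R (\<Sum>k<n. R (cis (2 * pi / n) ^ k * of_real s) - R (cis (2 * pi / n) ^ k))"
      using inverse_one_minus_power(2)[OF n invs] inverse_one_minus_power(2)[OF n inv1]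
      by (simp add: R_def sum_subtractf scaleR_diff_right flip: scaleC_scaleC)
    also have "norm \<dots> \<le> (1 / n) * (\<Sum>k<n. 1/6)"
      unfolding norm_scaleR
    proof (intro mult_mono order.trans[OF norm_sum] sum_mono)
      fix k
      let ?z = "cis (2 * pi / n) ^ k"
      have z: "cmod ?z = 1" by (simp add: norm_power)
      have "dist (?z * of_real s) ?z = cmod ?z * cmod (of_real s - 1)"
        by (simp only: dist_norm norm_mult[symmetric] right_diff_distrib mult_1_right)
      also have "complex_of_real s - 1 = of_real (s - 1)" by simp
      also have "cmod ?z * cmod (of_real (s - 1)) = 1 - s" using z s by (simp only: norm_of_real) simp
      finally have "dist (R (?z * of_real s)) (R ?z) < 1/6"
        using s z by (intro uc) (auto simp: norm_mult)
      then show "norm (R (?z * of_real s) - R ?z) \<le> 1/6" by (simp add: dist_norm)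
    qed auto
    also have "\<dots> = 1/6" using n by simp
    finally have 1: "norm (alg_inverse (1 - (s *\<^sub>R x) ^ n) - alg_inverse (1 - x ^ n)) \<le> 1/6" .
    have nx: "norm ((s *\<^sub>R x) ^ n) \<le> 1/7"
    proof -
      have "norm (s *\<^sub>R x) = s" using s x(2) by simp
      with norm_power_ineq[of "s *\<^sub>R x" n] sn show ?thesis by (simp only:)
    qed
    have "norm (alg_inverse (1 - (s *\<^sub>R x) ^ n) - 1) \<le> norm ((s *\<^sub>R x) ^ n) / (1 - norm ((s *\<^sub>R x) ^ n))"
      using nx by (intro neumann_series) auto
    also have "\<dots> \<le> (1/7) / (1 - 1/7)" using nx by (intro frac_le) auto
    finally have "norm (alg_inverse (1 - (s *\<^sub>R x) ^ n) - 1) \<le> 1/6" by simp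
    with 1 have "norm (1 - alg_inverse (1 - x ^ n)) \<le> 1/6 + 1/6"
      by (intro norm_diff_triangle_le[of _ "alg_inverse (1 - (s *\<^sub>R x) ^ n)"])
        (simp_all add: norm_minus_commute)
    then have u: "norm (1 - alg_inverse (1 - x ^ n)) \<le> 1/3" by simp
    let ?u = "alg_inverse (1 - x ^ n)"
    have invn: "alg_invertible (1 - x ^ n)" using n inv1 by (rule inverse_one_minus_power(1))
    \<comment> \<open>The roles are exchanged: \<open>1 - x ^ n\<close> is the inverse of
      \<open>?u\<close>, which is near 1, so the Neumann bound applies to it.\<close>
    have "is_inverse_of (1 - x ^ n) ?u"
      using is_inverse_of_alg_inverse[OF invn] by (simp add: is_inverse_of_def)
    then have "alg_inverse (1 - (1 - ?u)) = 1 - x ^ n" by (simp add: alg_inverse_eq)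
    then have "norm (x ^ n) \<le> norm (1 - ?u) / (1 - norm (1 - ?u))"
      using neumann_series(3)[of "1 - ?u"] u by simp
    also have "\<dots> \<le> (1/3) / (1 - 1/3)" using u by (intro frac_le) auto
    finally have "norm (x ^ n) < 1" by simp
    moreover have "norm (x ^ n) = 1"
      unfolding n_def using norm_self_adjoint_power_two[OF x(1)] x(2) by simp
    ultimately show False by simp
  qed
qed

section \<open>Continuous functional calculus of a self-adjoint element\<close>

lemma poly_map_poly_of_real [simp]:
  "poly (map_poly complex_of_real p) (complex_of_real t) = complex_of_real (poly p t)"
  by (induction p) (simp_all add: map_poly_pCons)

lemma real_spectrum_norm_le: "t \<in> real_spectrum a \<Longrightarrow> \<bar>t\<bar> \<le> norm (a::'a::cstar_algebra)"
  using norm_spectrum_le[of "of_real t" a] by (simp add: real_spectrum_def)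

lemma compact_real_spectrum: "compact (real_spectrum (a::'a::cstar_algebra))"
proof -
  have "closed (of_real -` spectrum a :: real set)"
    by (intro closed_vimage closed_spectrum continuous_intros)
  moreover have "bounded (real_spectrum a)"
    using real_spectrum_norm_le by (auto simp: bounded_real)
  ultimately show ?thesis
    by (simp add: compact_eq_bounded_closed real_spectrum_def vimage_def)
qed

lemma real_spectrum_borel [measurable]: "real_spectrum (a::'a::cstar_algebra) \<in> sets borel"
  by (rule borel_compact[OF compact_real_spectrum])

lemma spectrum_self_adjointE:
  assumes "adj a = (a::'a::cstar_algebra)" "z \<in> spectrum a"
  obtains t where "t \<in> real_spectrum a" "z = of_real t"
  using spectrum_self_adjoint[OF assms] assms(2) by (auto simp: real_spectrum_def Reals_def)

lemma real_spectrum_nonempty: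
  assumes "adj a = (a::'a::cstar_algebra)"
  shows "real_spectrum a \<noteq> {}"
  using norm_in_spectrum[OF assms] spectrum_self_adjointE[OF assms] by (metis empty_iff)

lemma spectrum_poly_elemE:
  assumes a: "adj a = (a::'a::cstar_algebra)" and z: "z \<in> spectrum (poly_elem p a)"
  obtains t where "t \<in> real_spectrum a" "poly p (of_real t) = z"
\<comment> \<open>A constant \<open>p\<close> must be treated apart, since factorisation into roots
  needs a nonzero polynomial; any point of the nonempty spectrum then serves.\<close>
proof (cases "p - [:z:] = 0")
  case True
  obtain t where "t \<in> real_spectrum a" using real_spectrum_nonempty[OF a] by auto
  moreover have "poly p (of_real t) = z" using True by simp
  ultimately show ?thesis by (rule that)
next
  case False
  have "\<not> alg_invertible (poly_elem (p - [:z:]) a)"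
    using z by (simp add: spectrum_def poly_elem_diff)
  then obtain w where "w \<in> spectrum a" "poly (p - [:z:]) w = 0"
    using notin_spectrum_poly[OF False] by blast
  then show ?thesis using spectrum_self_adjointE[OF a] that by (metis eq_iff_diff_eq_0 poly_diff poly_pCons mult_zero_right poly_0 add.right_neutral)
qed

text \<open>The C*-identity replaces \<open>p\<close> by the self-adjoint
  \<open>map_poly cnj p * p\<close>, whose norm is the modulus of a spectral value, hence equal to
  the squared modulus of \<open>p\<close> at some point of the spectrum of \<open>a\<close>.\<close>

lemma norm_poly_elem_le:
  assumes a: "adj a = (a::'a::cstar_algebra)"
    and B: "\<And>t. t \<in> real_spectrum a \<Longrightarrow> cmod (poly p (of_real t)) \<le> B"
  shows "norm (poly_elem p a) \<le> B"
proof -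
  let ?r = "map_poly cnj p * p"
  have eq: "adj (poly_elem p a) * poly_elem p a = poly_elem ?r a"
    by (simp add: poly_elem_mult adj_poly_elem[OF a])
  have "adj (poly_elem ?r a) = poly_elem ?r a"
    by (simp add: adj_mult adj_adj flip: eq)
  then obtain z where z: "z \<in> spectrum (poly_elem ?r a)" "cmod z = norm (poly_elem ?r a)"
    by (rule norm_in_spectrum)
  obtain t where t: "t \<in> real_spectrum a" "poly ?r (of_real t) = z"
    using spectrum_poly_elemE[OF a z(1)] by blast
  have "(norm (poly_elem p a))\<^sup>2 = cmod z" using z(2) cstar_identity[of "poly_elem p a"] eq by simp
  also have "\<dots> = (cmod (poly p (of_real t)))\<^sup>2"
    using t(2) by (simp add: poly_cnj_of_real norm_mult power2_eq_square flip: t(2))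
  also have "\<dots> \<le> B\<^sup>2" using B[OF t(1)] by (simp add: power_mono)
  finally show ?thesis
    using B[OF t(1)] by (smt (verit) norm_ge_zero power2_le_imp_le)
qed

lemma real_polynomial_approximation:
  fixes f :: "real \<Rightarrow> real"
  assumes "compact S" "continuous_on S f" "e > 0"
  obtains p where "\<And>t. t \<in> S \<Longrightarrow> \<bar>f t - poly p t\<bar> < e"
proof -
  obtain g where g: "polynomial_function g" "\<forall>x\<in>S. norm (f x - g x) < e"
    using Stone_Weierstrass_polynomial_function[OF assms] by blast
  then obtain c n where "g = (\<lambda>x. \<Sum>i\<le>n. c i * x ^ i)"
    by (auto simp: real_polynomial_function_eq[symmetric] real_polynomial_function_iff_sum)
  then have "g t = poly (\<Sum>i\<le>n. monom (c i) i) t" for t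
    by (simp add: poly_sum poly_monom)
  with g(2) show ?thesis by (intro that) auto
qed

lemma polynomial_approximation:
  fixes f :: "real \<Rightarrow> complex"
  assumes S: "compact S" and f: "continuous_on S f"
  obtains p where "uniform_limit S (\<lambda>n t. poly (p n) (complex_of_real t)) f sequentially"
proof -
  have "\<exists>q. \<forall>t\<in>S. cmod (f t - poly q (complex_of_real t)) < e" if e: "e > 0" for e
  proof -
    obtain p where p: "\<And>t. t \<in> S \<Longrightarrow> \<bar>Re (f t) - poly p t\<bar> < e / 2"
      by (rule real_polynomial_approximation[OF S, of "\<lambda>t. Re (f t)" "e/2"])
        (use e f in \<open>auto intro: continuous_intros\<close>)
    obtain q where q: "\<And>t. t \<in> S \<Longrightarrow> \<bar>Im (f t) - poly q t\<bar> < e / 2"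
      by (rule real_polynomial_approximation[OF S, of "\<lambda>t. Im (f t)" "e/2"])
        (use e f in \<open>auto intro: continuous_intros\<close>)
    let ?q = "map_poly of_real p + smult \<i> (map_poly of_real q)"
    have "cmod (f t - poly ?q (complex_of_real t)) < e" if "t \<in> S" for t
      using p[OF that] q[OF that] cmod_le[of "f t - poly ?q (complex_of_real t)"] by simp
    then show ?thesis by blast
  qed
  then have "\<forall>n. \<exists>q. \<forall>t\<in>S. cmod (f t - poly q (complex_of_real t)) < 1 / Suc n" by simp
  then obtain p where p: "\<And>n t. t \<in> S \<Longrightarrow> cmod (f t - poly (p n) (complex_of_real t)) < 1 / Suc n"
    by metis
  have "uniform_limit S (\<lambda>n t. poly (p n) (complex_of_real t)) f sequentially"
  proof (rule uniform_limitI)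
    fix e :: real assume "e > 0"
    then have "\<forall>\<^sub>F n in sequentially. 1 / Suc n < e"
      by (metis (mono_tags, lifting) LIMSEQ_inverse_real_of_nat eventually_mono inverse_eq_divide order_tendstoD(2))
    then show "\<forall>\<^sub>F n in sequentially. \<forall>t\<in>S. dist (poly (p n) (complex_of_real t)) (f t) < e"
    proof eventually_elim
      case (elim n)
      then show ?case using p[of _ n] by (auto simp: dist_norm norm_minus_commute intro: less_trans)
    qed
  qed
  then show ?thesis by (rule that)
qed

lemma poly_elem_tendsto_0:
  assumes a: "adj a = (a::'a::cstar_algebra)"
    and p: "uniform_limit (real_spectrum a) (\<lambda>n t. poly (p n) (complex_of_real t)) (\<lambda>_. 0) F"
  shows "((\<lambda>n. poly_elem (p n) a) \<longlongrightarrow> 0) F"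
proof (rule tendstoI)
  fix e :: real assume "e > 0"
  then have "\<forall>\<^sub>F n in F. \<forall>t\<in>real_spectrum a. dist (poly (p n) (complex_of_real t)) 0 < e / 2"
    using p by (intro uniform_limitD) auto
  then show "\<forall>\<^sub>F n in F. dist (poly_elem (p n) a) 0 < e"
  proof eventually_elim
    case (elim n)
    then have "norm (poly_elem (p n) a) \<le> e / 2" by (intro norm_poly_elem_le[OF a]) (auto intro: less_imp_le)
    with \<open>e > 0\<close> show ?case by simp
  qed
qed

text \<open>This justifies the definite description: the norm bound for polynomials turns uniform
  Cauchy sequences into Cauchy sequences of elements, and two approximating sequences differ by a
  null sequence. Uniqueness rests on the existence of at least one approximating sequence.\<close>

lemma cfun_calc_tendsto:
  assumes a: "adj a = (a::'a::cstar_algebra)" and f: "continuous_on (real_spectrum a) f"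
    and p: "uniform_limit (real_spectrum a) (\<lambda>n t. poly (p n) (complex_of_real t)) f sequentially"
  shows "(\<lambda>n. poly_elem (p n) a) \<longlonglongrightarrow> cfun_calc f a"
proof -
  let ?S = "real_spectrum a"
  obtain r where r: "uniform_limit ?S (\<lambda>n t. poly (r n) (complex_of_real t)) f sequentially"
    using polynomial_approximation[OF compact_real_spectrum f] by blast
  have "Cauchy (\<lambda>n. poly_elem (r n) a)"
  proof (rule metric_CauchyI)
    fix e :: real assume "e > 0"
    have "uniformly_Cauchy_on ?S (\<lambda>n t. poly (r n) (complex_of_real t))"
      using r by (intro uniformly_convergent_Cauchy) (auto simp: uniformly_convergent_on_def)
    then obtain N where N: "\<And>m n t. m \<ge> N \<Longrightarrow> n \<ge> N \<Longrightarrow> t \<in> ?S \<Longrightarrow>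
        dist (poly (r m) (complex_of_real t)) (poly (r n) (complex_of_real t)) < e / 2"
      using \<open>e > 0\<close> unfolding uniformly_Cauchy_on_def by (metis half_gt_zero)
    have "dist (poly_elem (r m) a) (poly_elem (r n) a) < e" if "m \<ge> N" "n \<ge> N" for m n
    proof -
      have "norm (poly_elem (r m - r n) a) \<le> e / 2"
        using N[OF that] by (intro norm_poly_elem_le[OF a]) (auto simp: dist_norm intro: less_imp_le)
      with \<open>e > 0\<close> show ?thesis by (simp add: dist_norm poly_elem_diff)
    qed
    then show "\<exists>N. \<forall>m\<ge>N. \<forall>n\<ge>N. dist (poly_elem (r m) a) (poly_elem (r n) a) < e" by blast
  qed
  then obtain b where b: "(\<lambda>n. poly_elem (r n) a) \<longlonglongrightarrow> b"
    by (auto simp: Cauchy_convergent_iff convergent_def)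
  have lim: "(\<lambda>n. poly_elem (q n) a) \<longlonglongrightarrow> b"
    if q: "uniform_limit ?S (\<lambda>n t. poly (q n) (complex_of_real t)) f sequentially" for q
  proof -
    have "uniform_limit ?S (\<lambda>n t. poly (q n - r n) (complex_of_real t)) (\<lambda>_. 0) sequentially"
      using uniform_limit_minus[OF q r] by simp
    from tendsto_add[OF poly_elem_tendsto_0[OF a this] b] show ?thesis
      by (simp add: poly_elem_diff)
  qed
  have "cfun_calc f a = b"
    unfolding cfun_calc_def
  proof (rule the_equality)
    fix c assume "\<forall>p. uniform_limit ?S (\<lambda>n t. poly (p n) (complex_of_real t)) f sequentially \<longrightarrow>
        (\<lambda>n. poly_elem (p n) a) \<longlonglongrightarrow> c"
    with r b show "c = b" using LIMSEQ_unique by blast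
  qed (use lim in blast)
  with lim[OF p] show ?thesis by simp
qed

lemma cfun_calc_poly:
  assumes "adj a = (a::'a::cstar_algebra)"
  shows "cfun_calc (\<lambda>t. poly p (complex_of_real t)) a = poly_elem p a"
proof -
  have "(\<lambda>n::nat. poly_elem p a) \<longlonglongrightarrow> cfun_calc (\<lambda>t. poly p (complex_of_real t)) a"
    by (intro cfun_calc_tendsto assms continuous_intros uniform_limit_const)
  then show ?thesis using LIMSEQ_unique tendsto_const by blast
qed

lemma cfun_calc_const: "adj a = (a::'a::cstar_algebra) \<Longrightarrow> cfun_calc (\<lambda>_. c) a = c *\<^sub>C 1"
  using cfun_calc_poly[of a "[:c:]"] by simp

lemma cfun_calc_ident: "adj a = (a::'a::cstar_algebra) \<Longrightarrow> cfun_calc complex_of_real a = a"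
  using cfun_calc_poly[of a "[:0, 1:]"] by simp

lemma cfun_calc_cong:
  assumes "\<And>t. t \<in> real_spectrum a \<Longrightarrow> f t = g t"
  shows "cfun_calc f a = cfun_calc g (a::'a::cstar_algebra)"
proof -
  have "uniform_limit (real_spectrum a) (\<lambda>n t. poly (p n) (complex_of_real t)) f sequentially \<longleftrightarrow>
      uniform_limit (real_spectrum a) (\<lambda>n t. poly (p n) (complex_of_real t)) g sequentially" for p
    using assms by (intro uniform_limit_cong') auto
  then show ?thesis by (simp add: cfun_calc_def)
qed

context
  fixes a :: "'a::cstar_algebra" and f :: "real \<Rightarrow> complex"
  assumes a: "adj a = a" and f: "continuous_on (real_spectrum a) f"
begin

lemma adj_cfun_calc: "adj (cfun_calc f a) = cfun_calc (\<lambda>t. cnj (f t)) a"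
proof -
  obtain p where p: "uniform_limit (real_spectrum a) (\<lambda>n t. poly (p n) (complex_of_real t)) f sequentially"
    using polynomial_approximation[OF compact_real_spectrum f] by blast
  have "uniform_limit (real_spectrum a) (\<lambda>n t. cnj (poly (p n) (complex_of_real t))) (\<lambda>t. cnj (f t)) sequentially"
    by (rule bounded_linear.uniform_limit[OF bounded_linear_cnj p])
  then have "(\<lambda>n. poly_elem (map_poly cnj (p n)) a) \<longlonglongrightarrow> cfun_calc (\<lambda>t. cnj (f t)) a"
    by (intro cfun_calc_tendsto a continuous_intros f) (simp add: poly_cnj_of_real)
  moreover have "(\<lambda>n. poly_elem (map_poly cnj (p n)) a) \<longlonglongrightarrow> adj (cfun_calc f a)"
    unfolding adj_poly_elem[OF a, symmetric] by (intro tendsto_adj cfun_calc_tendsto a f p)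
  ultimately show ?thesis using LIMSEQ_unique by blast
qed

text \<open>For polynomials this is spectral mapping together with the bound of spectral values by
  the norm; both sides pass to the limit. It is used to conclude from a vanishing
  \<open>cfun_calc\<close> that the function vanishes on the spectrum.\<close>

lemma norm_cfun_calc_ge:
  assumes t: "t \<in> real_spectrum a"
  shows "cmod (f t) \<le> norm (cfun_calc f a)"
proof -
  obtain p where p: "uniform_limit (real_spectrum a) (\<lambda>n t. poly (p n) (complex_of_real t)) f sequentially"
    using polynomial_approximation[OF compact_real_spectrum f] by blast
  have "(\<lambda>n. cmod (poly (p n) (complex_of_real t))) \<longlonglongrightarrow> cmod (f t)"
    by (intro tendsto_norm tendsto_uniform_limitI[OF p t])
  moreover have "(\<lambda>n. norm (poly_elem (p n) a)) \<longlonglongrightarrow> norm (cfun_calc f a)"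
    by (intro tendsto_norm cfun_calc_tendsto a f p)
  moreover have "cmod (poly (p n) (complex_of_real t)) \<le> norm (poly_elem (p n) a)" for n
    using t by (intro norm_spectrum_le poly_in_spectrum) (simp add: real_spectrum_def)
  ultimately show ?thesis by (intro LIMSEQ_le) auto
qed

lemma norm_cfun_calc_le:
  assumes B: "\<And>t. t \<in> real_spectrum a \<Longrightarrow> cmod (f t) \<le> B"
  shows "norm (cfun_calc f a) \<le> B"
proof (rule field_le_epsilon)
  fix e :: real assume "e > 0"
  obtain p where p: "uniform_limit (real_spectrum a) (\<lambda>n t. poly (p n) (complex_of_real t)) f sequentially"
    using polynomial_approximation[OF compact_real_spectrum f] by blast
  have lim: "(\<lambda>n. norm (poly_elem (p n) a)) \<longlonglongrightarrow> norm (cfun_calc f a)"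
    by (intro tendsto_norm cfun_calc_tendsto a f p)
  have "\<forall>\<^sub>F n in sequentially. \<forall>t\<in>real_spectrum a. dist (poly (p n) (complex_of_real t)) (f t) < e"
    by (rule uniform_limitD[OF p \<open>e > 0\<close>])
  then have "\<forall>\<^sub>F n in sequentially. norm (poly_elem (p n) a) \<le> B + e"
  proof eventually_elim
    case (elim n)
    show ?case
    proof (rule norm_poly_elem_le[OF a])
      fix t assume t: "t \<in> real_spectrum a"
      have "cmod (poly (p n) (complex_of_real t)) \<le> cmod (f t) + cmod (poly (p n) (complex_of_real t) - f t)"
        by (rule norm_triangle_sub)
      then show "cmod (poly (p n) (complex_of_real t)) \<le> B + e"
        using B[OF t] elim t by (force simp: dist_norm)
    qed
  qed
  with lim show "norm (cfun_calc f a) \<le> B + e" by (intro tendsto_upperbound) auto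
qed

context
  fixes g :: "real \<Rightarrow> complex"
  assumes g: "continuous_on (real_spectrum a) g"
begin

lemma cfun_calc_add: "cfun_calc (\<lambda>t. f t + g t) a = cfun_calc f a + cfun_calc g a"
proof -
  obtain p where p: "uniform_limit (real_spectrum a) (\<lambda>n t. poly (p n) (complex_of_real t)) f sequentially"
    using polynomial_approximation[OF compact_real_spectrum f] by blast
  obtain q where q: "uniform_limit (real_spectrum a) (\<lambda>n t. poly (q n) (complex_of_real t)) g sequentially"
    using polynomial_approximation[OF compact_real_spectrum g] by blast
  have "(\<lambda>n. poly_elem (p n + q n) a) \<longlonglongrightarrow> cfun_calc (\<lambda>t. f t + g t) a"
    using uniform_limit_add[OF p q] by (intro cfun_calc_tendsto a continuous_intros f g) simp
  moreover have "(\<lambda>n. poly_elem (p n + q n) a) \<longlonglongrightarrow> cfun_calc f a + cfun_calc g a"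
    unfolding poly_elem_add by (intro tendsto_add cfun_calc_tendsto a f g p q)
  ultimately show ?thesis by (rule LIMSEQ_unique)
qed

lemma cfun_calc_mult: "cfun_calc (\<lambda>t. f t * g t) a = cfun_calc f a * cfun_calc g a"
proof -
  obtain p where p: "uniform_limit (real_spectrum a) (\<lambda>n t. poly (p n) (complex_of_real t)) f sequentially"
    using polynomial_approximation[OF compact_real_spectrum f] by blast
  obtain q where q: "uniform_limit (real_spectrum a) (\<lambda>n t. poly (q n) (complex_of_real t)) g sequentially"
    using polynomial_approximation[OF compact_real_spectrum g] by blast
  have "bounded (f ` real_spectrum a)" "bounded (g ` real_spectrum a)"
    by (intro compact_imp_bounded compact_continuous_image compact_real_spectrum f g)+
  with p q have "uniform_limit (real_spectrum a) (\<lambda>n t. poly (p n) (complex_of_real t) * poly (q n) (complex_of_real t))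
      (\<lambda>t. f t * g t) sequentially"
    by (intro uniform_lim_mult)
  then have "(\<lambda>n. poly_elem (p n * q n) a) \<longlonglongrightarrow> cfun_calc (\<lambda>t. f t * g t) a"
    by (intro cfun_calc_tendsto a continuous_intros f g) simp
  moreover have "(\<lambda>n. poly_elem (p n * q n) a) \<longlonglongrightarrow> cfun_calc f a * cfun_calc g a"
    unfolding poly_elem_mult by (intro tendsto_mult cfun_calc_tendsto a f g p q)
  ultimately show ?thesis by (rule LIMSEQ_unique)
qed

end

end

lemma cfun_calc_diff:
  assumes a: "adj a = (a::'a::cstar_algebra)"
    and f: "continuous_on (real_spectrum a) f" and g: "continuous_on (real_spectrum a) g"
  shows "cfun_calc (\<lambda>t. f t - g t) a = cfun_calc f a - cfun_calc g a"
proof -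
  have "cfun_calc (\<lambda>t. (f t - g t) + g t) a = cfun_calc (\<lambda>t. f t - g t) a + cfun_calc g a"
    by (intro cfun_calc_add a f g continuous_intros)
  then show ?thesis by simp
qed

lemma cfun_calc_scaleC:
  assumes a: "adj a = (a::'a::cstar_algebra)" and f: "continuous_on (real_spectrum a) f"
  shows "cfun_calc (\<lambda>t. c * f t) a = c *\<^sub>C cfun_calc f a"
  using cfun_calc_mult[OF a continuous_on_const f, of c]
  by (simp add: cfun_calc_const[OF a] mult_scaleC_left)

lemma cfun_calc_sum:
  assumes a: "adj a = (a::'a::cstar_algebra)"
    and f: "\<And>i. i \<in> I \<Longrightarrow> continuous_on (real_spectrum a) (f i)"
  shows "cfun_calc (\<lambda>t. \<Sum>i\<in>I. f i t) a = (\<Sum>i\<in>I. cfun_calc (f i) a)"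
  using f
  by (induction I rule: infinite_finite_induct)
    (simp_all add: cfun_calc_const[OF a] cfun_calc_add[OF a] continuous_on_sum)

lemma cfun_calc_uniform_limit:
  assumes a: "adj a = (a::'a::cstar_algebra)"
    and f: "\<And>n::nat. continuous_on (real_spectrum a) (f n)" and g: "continuous_on (real_spectrum a) g"
    and lim: "uniform_limit (real_spectrum a) f g sequentially"
  shows "(\<lambda>n. cfun_calc (f n) a) \<longlonglongrightarrow> cfun_calc g a"
proof (rule tendstoI)
  fix e :: real assume "e > 0"
  then have "\<forall>\<^sub>F n in sequentially. \<forall>t\<in>real_spectrum a. dist (f n t) (g t) < e / 2"
    using lim by (intro uniform_limitD) auto
  then show "\<forall>\<^sub>F n in sequentially. dist (cfun_calc (f n) a) (cfun_calc g a) < e"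
  proof eventually_elim
    case (elim n)
    have "norm (cfun_calc (\<lambda>t. f n t - g t) a) \<le> e / 2"
      by (rule norm_cfun_calc_le[OF a])
        (use elim in \<open>auto simp: dist_norm intro!: less_imp_le continuous_intros f g\<close>)
    then show ?case
      using \<open>e > 0\<close> by (simp add: cfun_calc_diff[OF a f g] dist_norm)
  qed
qed

section \<open>Positive elements and square roots\<close>

lemma positive_element_real_spectrum_nonneg:
  "positive_element a \<Longrightarrow> t \<in> real_spectrum a \<Longrightarrow> 0 \<le> t"
  by (auto simp: positive_element_def real_spectrum_def)

lemma positive_elementI:
  assumes "adj a = (a::'a::cstar_algebra)" and "\<And>t. t \<in> real_spectrum a \<Longrightarrow> 0 \<le> t"
  shows "positive_element a"
  unfolding positive_element_def
  using assms spectrum_self_adjointE[OF assms(1)] by (metis nonneg_Reals_of_real_iff subsetI)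

lemma positive_element_square:
  assumes c: "adj c = (c::'a::cstar_algebra)"
  shows "positive_element (c * c)"
proof (rule positive_elementI)
  show "adj (c * c) = c * c" by (simp add: adj_mult c)
  fix t assume "t \<in> real_spectrum (c * c)"
  then have "complex_of_real t \<in> spectrum (poly_elem [:0, 0, 1:] c)"
    by (simp add: real_spectrum_def)
  then obtain s where "poly [:0, 0, 1:] (complex_of_real s) = complex_of_real t"
    using spectrum_poly_elemE[OF c] by blast
  then have "complex_of_real (s * s) = complex_of_real t" by simp
  then have "t = s * s" by (simp only: of_real_eq_iff)
  then show "0 \<le> t" by simp
qed

lemma cfun_calc_square_root:
  assumes a: "adj a = (a::'a::cstar_algebra)" and g: "continuous_on (real_spectrum a) g"
    and nonneg: "\<And>t. t \<in> real_spectrum a \<Longrightarrow> 0 \<le> g t"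
  shows "adj (cfun_calc (\<lambda>t. complex_of_real (sqrt (g t))) a) = cfun_calc (\<lambda>t. complex_of_real (sqrt (g t))) a"
    and "cfun_calc (\<lambda>t. complex_of_real (sqrt (g t))) a * cfun_calc (\<lambda>t. complex_of_real (sqrt (g t))) a =
      cfun_calc (\<lambda>t. complex_of_real (g t)) a"
proof -
  have cont: "continuous_on (real_spectrum a) (\<lambda>t. complex_of_real (sqrt (g t)))"
    by (intro continuous_intros g)
  show "adj (cfun_calc (\<lambda>t. complex_of_real (sqrt (g t))) a) = cfun_calc (\<lambda>t. complex_of_real (sqrt (g t))) a"
    using adj_cfun_calc[OF a cont] by simp
  have "cfun_calc (\<lambda>t. complex_of_real (g t)) a =
      cfun_calc (\<lambda>t. complex_of_real (sqrt (g t)) * complex_of_real (sqrt (g t))) a"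
    using nonneg by (intro cfun_calc_cong) (simp flip: of_real_mult)
  then show "cfun_calc (\<lambda>t. complex_of_real (sqrt (g t))) a * cfun_calc (\<lambda>t. complex_of_real (sqrt (g t))) a =
      cfun_calc (\<lambda>t. complex_of_real (g t)) a"
    by (simp add: cfun_calc_mult[OF a cont cont])
qed

text \<open>This yields uniqueness of positive square roots: \<open>b\<close> is recovered from
  \<open>b * b\<close>. If polynomials approximate the square root on the spectrum of
  \<open>b * b\<close>, then composed with squaring they approximate the identity on the spectrum of
  \<open>b\<close>, where values are nonnegative.\<close>

lemma positive_square_root_eq:
  assumes b: "positive_element b"
  shows "cfun_calc (\<lambda>t. complex_of_real (sqrt t)) (b * b) = (b::'a::cstar_algebra)"
proof -
  let ?f = "\<lambda>t. complex_of_real (sqrt t)"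
  have sa: "adj b = b" using b by (simp add: positive_element_def)
  have sq: "adj (b * b) = b * b" by (simp add: adj_mult sa)
  obtain p where p: "uniform_limit (real_spectrum (b * b)) (\<lambda>n t. poly (p n) (complex_of_real t)) ?f sequentially"
    by (rule polynomial_approximation[OF compact_real_spectrum, of "b * b" ?f]) (auto intro: continuous_intros)
  have mem: "t * t \<in> real_spectrum (b * b)" if "t \<in> real_spectrum b" for t
    using poly_in_spectrum[of "of_real t" b "[:0, 0, 1:]"] that by (simp add: real_spectrum_def)
  have "uniform_limit (real_spectrum b) (\<lambda>n t. poly (pcompose (p n) [:0, 0, 1:]) (complex_of_real t))
      complex_of_real sequentially"
  proof (rule uniform_limitI)
    fix e :: real assume "e > 0"
    from uniform_limitD[OF p this]
    show "\<forall>\<^sub>F n in sequentially. \<forall>t\<in>real_spectrum b.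
        dist (poly (pcompose (p n) [:0, 0, 1:]) (complex_of_real t)) (complex_of_real t) < e"
    proof eventually_elim
      case (elim n)
      have "dist (poly (p n) (complex_of_real (t * t))) (complex_of_real t) < e" if "t \<in> real_spectrum b" for t
        using bspec[OF elim mem[OF that]] positive_element_real_spectrum_nonneg[OF b that] by simp
      then show ?case by (simp add: poly_pcompose)
    qed
  qed
  then have "(\<lambda>n. poly_elem (pcompose (p n) [:0, 0, 1:]) b) \<longlonglongrightarrow> cfun_calc complex_of_real b"
    by (intro cfun_calc_tendsto sa continuous_intros)
  then have "(\<lambda>n. poly_elem (p n) (b * b)) \<longlonglongrightarrow> b"
    by (simp add: cfun_calc_ident[OF sa] poly_elem_pcompose)
  moreover have "(\<lambda>n. poly_elem (p n) (b * b)) \<longlonglongrightarrow> cfun_calc ?f (b * b)"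
    by (intro cfun_calc_tendsto sq continuous_intros p)
  ultimately show ?thesis using LIMSEQ_unique by blast
qed

lemma alg_sqrt:
  assumes a: "positive_element (a::'a::cstar_algebra)"
  shows "positive_element (alg_sqrt a)" and "alg_sqrt a * alg_sqrt a = a"
proof -
  have sa: "adj a = a" using a by (simp add: positive_element_def)
  note pos = positive_element_real_spectrum_nonneg[OF a]
  define b where "b = cfun_calc (\<lambda>t. complex_of_real (sqrt t)) a"
  \<comment> \<open>The fourth root exhibits \<open>b\<close> as the square of a self-adjoint
    element, which makes \<open>b\<close> positive.\<close>
  define c where "c = cfun_calc (\<lambda>t. complex_of_real (sqrt (sqrt t))) a"
  have "adj c = c" "c * c = b"
    unfolding b_def c_def using pos by (auto intro!: cfun_calc_square_root sa continuous_intros)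
  then have b: "positive_element b" using positive_element_square by metis
  have "b * b = a"
    using cfun_calc_square_root(2)[OF sa, of "\<lambda>t. t"] pos cfun_calc_ident[OF sa]
    by (simp add: b_def continuous_on_id)
  have "alg_sqrt a = b"
    unfolding alg_sqrt_def b_def
    using b \<open>b * b = a\<close> by (intro the_equality) (auto simp: b_def positive_square_root_eq)
  with b \<open>b * b = a\<close> show "positive_element (alg_sqrt a)" "alg_sqrt a * alg_sqrt a = a" by simp_all
qed

section \<open>Elementary properties of the state, and positivity of
  \<open>adj x * x\<close>\<close>

context
  fixes \<phi> :: "'a::cstar_algebra \<Rightarrow> complex"
  assumes \<phi>: "faithful_tracial_state \<phi>"
begin

lemma state_add: "\<phi> (a + b) = \<phi> a + \<phi> b"
  and state_scaleC: "\<phi> (c *\<^sub>C a) = c * \<phi> a"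
  and state_nonneg: "\<phi> (adj a * a) \<in> \<real>\<^sub>\<ge>\<^sub>0"
  and state_1: "\<phi> 1 = 1"
  and state_trace: "\<phi> (a * b) = \<phi> (b * a)"
  and state_faithful: "a \<noteq> 0 \<Longrightarrow> 0 < Re (\<phi> (adj a * a))"
  using \<phi> by (auto simp: faithful_tracial_state_def)

lemma state_0: "\<phi> 0 = 0"
  using state_add[of 0 0] by simp

lemma state_minus: "\<phi> (- a) = - \<phi> a"
  using state_scaleC[of "-1" a] by simp

lemma state_diff: "\<phi> (a - b) = \<phi> a - \<phi> b"
  using state_add[of a "- b"] by (simp add: state_minus)

lemma state_scaleR: "\<phi> (r *\<^sub>R a) = of_real r * \<phi> a"
  using state_scaleC[of "of_real r" a] by simp

lemma state_sum: "\<phi> (\<Sum>i\<in>I. f i) = (\<Sum>i\<in>I. \<phi> (f i))"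
  by (induction I rule: infinite_finite_induct) (simp_all add: state_0 state_add)

text \<open>With \<open>a = x\<^sup>* x\<close> and \<open>c\<close> the square root of the negative part of \<open>a\<close> one has \<open>c a c = - c\<^sup>4\<close>,
  while \<open>\<phi> (c a c) = \<phi> ((x c)\<^sup>* (x c)) \<ge> 0\<close>. Faithfulness forces \<open>c = 0\<close>.\<close>

lemma positive_element_adj_mult: "positive_element (adj x * (x::'a))"
proof -
  define a where "a = adj x * x"
  have sa: "adj a = a" by (simp add: a_def adj_mult adj_adj)
  let ?S = "real_spectrum a"
  let ?g = "\<lambda>t::real. max 0 (- t)"
  define c where "c = cfun_calc (\<lambda>t. complex_of_real (sqrt (?g t))) a"
  have g: "continuous_on ?S ?g" by (intro continuous_intros)
  have c: "adj c = c" "c * c = cfun_calc (\<lambda>t. complex_of_real (?g t)) a"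
    unfolding c_def by (rule cfun_calc_square_root[OF sa g]; simp)+
  have "c * a * c = c * cfun_calc complex_of_real a * c" by (simp add: cfun_calc_ident[OF sa])
  also have "\<dots> = cfun_calc (\<lambda>t. complex_of_real (sqrt (?g t)) * complex_of_real t * complex_of_real (sqrt (?g t))) a"
    unfolding c_def
    by (subst cfun_calc_mult[OF sa], (intro continuous_intros)+, subst cfun_calc_mult[OF sa], (intro continuous_intros)+) simp
  also have "\<dots> = cfun_calc (\<lambda>t. (- 1) * (complex_of_real (?g t) * complex_of_real (?g t))) a"
  proof (rule cfun_calc_cong)
    fix t :: real
    have "sqrt (?g t) * t * sqrt (?g t) = - (?g t * ?g t)"
    proof -
      have "sqrt (?g t) * t * sqrt (?g t) = t * (sqrt (?g t) * sqrt (?g t))" by (simp only: mult_ac)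
      also have "\<dots> = t * ?g t" by simp
      also have "\<dots> = - (?g t * ?g t)" by (simp add: max_def)
      finally show ?thesis .
    qed
    then have "complex_of_real (sqrt (?g t) * t * sqrt (?g t)) = complex_of_real (- (?g t * ?g t))" by (rule arg_cong)
    then show "complex_of_real (sqrt (?g t)) * complex_of_real t * complex_of_real (sqrt (?g t)) =
      (- 1) * (complex_of_real (?g t) * complex_of_real (?g t))" by simp
  qed
  also have "\<dots> = (- 1) *\<^sub>C ((c * c) * (c * c))"
    unfolding c(2) by (subst cfun_calc_scaleC[OF sa], (intro continuous_intros)+, subst cfun_calc_mult[OF sa], (intro continuous_intros)+) simp
  finally have "c * a * c = - ((c * c) * (c * c))" by simp
  moreover have "c * a * c = adj (x * c) * (x * c)"
    by (simp add: a_def adj_mult c(1) mult.assoc)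
  moreover have "(c * c) * (c * c) = adj (c * c) * (c * c)"
    by (simp add: adj_mult c(1))
  ultimately have "\<phi> (adj (c * c) * (c * c)) = - \<phi> (adj (x * c) * (x * c))"
    by (metis state_minus minus_minus)
  then have "Re (\<phi> (adj (c * c) * (c * c))) \<le> 0"
    using state_nonneg[of "x * c"] by (simp add: complex_nonneg_Reals_iff)
  then have "c * c = 0" using state_faithful[of "c * c"] by fastforce
  then have 0: "cfun_calc (\<lambda>t. complex_of_real (?g t)) a = 0" using c(2) by simp
  have "positive_element a"
  proof (rule positive_elementI[OF sa])
    fix t assume t: "t \<in> ?S"
    have "cmod (complex_of_real (?g t)) \<le> norm (cfun_calc (\<lambda>t. complex_of_real (?g t)) a)"
      by (rule norm_cfun_calc_ge[OF sa _ t]) (intro continuous_intros)+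
    with 0 show "0 \<le> t" by simp
  qed
  then show ?thesis by (simp add: a_def)
qed

lemma positive_alg_abs: "positive_element (alg_abs (x::'a))"
  and alg_abs_square: "alg_abs x * alg_abs x = adj x * (x::'a)"
  unfolding alg_abs_def by (rule alg_sqrt[OF positive_element_adj_mult])+

end

section \<open>Cauchy--Schwarz inequality and norm of a state\<close>

context
  fixes \<phi> :: "'a::cstar_algebra \<Rightarrow> complex"
  assumes \<phi>: "faithful_tracial_state \<phi>"
begin

lemma state_square_real: "\<phi> (adj a * a) \<in> \<real>"
  using state_nonneg[OF \<phi>] by (auto simp: complex_is_Real_iff complex_nonneg_Reals_iff)

text \<open>The state is known to be real on elements \<open>adj a * a\<close> only; expanding the
  square of \<open>s + 1\<close> isolates the linear term.\<close>

lemma state_self_adjoint_real: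
  assumes s: "adj s = s"
  shows "\<phi> s \<in> \<real>"
proof -
  have "adj (s + 1) * (s + 1) = adj s * s + 2 *\<^sub>R s + 1"
    by (simp add: adj_add s algebra_simps scaleR_2)
  then have "\<phi> (adj (s + 1) * (s + 1)) = \<phi> (adj s * s) + 2 * \<phi> s + 1"
    by (simp add: state_add[OF \<phi>] state_scaleR[OF \<phi>] state_1[OF \<phi>])
  then show ?thesis
    using state_square_real[of "s + 1"] state_square_real[of s] by (simp add: complex_is_Real_iff)
qed

lemma state_adj: "\<phi> (adj x) = cnj (\<phi> x)"
proof -
  have "\<phi> (x + adj x) \<in> \<real>"
    by (rule state_self_adjoint_real) (simp add: adj_add adj_adj add.commute)
  moreover have "\<phi> (\<i> *\<^sub>C (x - adj x)) \<in> \<real>"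
    by (rule state_self_adjoint_real)
      (simp add: adj_scaleC adj_diff adj_adj scaleC.diff_right)
  ultimately show ?thesis
    by (simp add: state_add[OF \<phi>] state_diff[OF \<phi>] state_scaleC[OF \<phi>] complex_is_Real_iff complex_eq_iff)
qed

lemma state_Cauchy_Schwarz:
  "(cmod (\<phi> (adj b * a)))\<^sup>2 \<le> Re (\<phi> (adj b * b)) * Re (\<phi> (adj a * a))"
proof (cases "b = 0")
  case True
  then show ?thesis by (simp add: state_0[OF \<phi>])
next
  case False
  define \<beta> where "\<beta> = Re (\<phi> (adj b * b))"
  have \<beta>: "\<beta> > 0" using state_faithful[OF \<phi> False] by (simp add: \<beta>_def)
  define c where "c = \<phi> (adj b * a)"
  \<comment> \<open>The coefficient of the orthogonal projection of \<open>a\<close> onto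
    \<open>b\<close>. It minimises the left-hand side of the expansion below, so that nonnegativity
    becomes the inequality.\<close>
  define k where "k = c / of_real \<beta>"
  have ab: "\<phi> (adj a * b) = cnj c"
    using state_adj[of "adj b * a"] by (simp add: c_def adj_mult adj_adj)
  have bb: "\<phi> (adj b * b) = of_real \<beta>"
    using state_square_real[of b] by (simp add: \<beta>_def complex_is_Real_iff complex_eq_iff)
  have "adj (a - k *\<^sub>C b) * (a - k *\<^sub>C b) =
      adj a * a - k *\<^sub>C (adj a * b) - cnj k *\<^sub>C (adj b * a) + (cnj k * k) *\<^sub>C (adj b * b)"
    by (simp add: adj_diff adj_scaleC algebra_simps mult_scaleC_left mult_scaleC_right scaleC_scaleC scaleC.diff_right)
  then have "\<phi> (adj (a - k *\<^sub>C b) * (a - k *\<^sub>C b)) =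
      \<phi> (adj a * a) - k * cnj c - cnj k * c + cnj k * k * of_real \<beta>"
    by (simp add: state_add[OF \<phi>] state_diff[OF \<phi>] state_scaleC[OF \<phi>] ab bb flip: c_def)
  also have "\<dots> = \<phi> (adj a * a) - of_real ((cmod c)\<^sup>2 / \<beta>)"
    using \<beta> by (simp add: k_def field_simps) (simp add: complex_norm_square[symmetric])
  finally have "0 \<le> Re (\<phi> (adj a * a)) - (cmod c)\<^sup>2 / \<beta>"
    using state_nonneg[OF \<phi>, of "a - k *\<^sub>C b"] by (simp add: complex_nonneg_Reals_iff)
  then show ?thesis using \<beta> by (simp add: c_def \<beta>_def field_simps)
qed

lemma state_cfun_calc_nonneg:
  assumes "adj a = a" "continuous_on (real_spectrum a) g" "\<And>t. t \<in> real_spectrum a \<Longrightarrow> 0 \<le> g t"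
  shows "0 \<le> Re (\<phi> (cfun_calc (\<lambda>t. complex_of_real (g t)) a))"
proof -
  let ?c = "cfun_calc (\<lambda>t. complex_of_real (sqrt (g t))) a"
  have "adj ?c * ?c = cfun_calc (\<lambda>t. complex_of_real (g t)) a"
    using cfun_calc_square_root[OF assms] by simp
  then show ?thesis using state_nonneg[OF \<phi>, of ?c] by (simp add: complex_nonneg_Reals_iff)
qed

lemma state_cfun_calc_of_real:
  assumes a: "adj a = a" and g: "continuous_on (real_spectrum a) g"
  shows "\<phi> (cfun_calc (\<lambda>t. complex_of_real (g t)) a) =
    complex_of_real (Re (\<phi> (cfun_calc (\<lambda>t. complex_of_real (g t)) a)))"
proof -
  have "adj (cfun_calc (\<lambda>t. complex_of_real (g t)) a) = cfun_calc (\<lambda>t. complex_of_real (g t)) a"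
    using adj_cfun_calc[OF a, of "\<lambda>t. complex_of_real (g t)"] g by (simp add: continuous_on_of_real)
  from state_self_adjoint_real[OF this] show ?thesis by (simp add: complex_is_Real_iff complex_eq_iff)
qed

lemma state_cfun_calc_mono:
  assumes a: "adj a = a" and f: "continuous_on (real_spectrum a) f" and g: "continuous_on (real_spectrum a) g"
    and le: "\<And>t. t \<in> real_spectrum a \<Longrightarrow> f t \<le> g t"
  shows "Re (\<phi> (cfun_calc (\<lambda>t. complex_of_real (f t)) a)) \<le> Re (\<phi> (cfun_calc (\<lambda>t. complex_of_real (g t)) a))"
proof -
  have "0 \<le> Re (\<phi> (cfun_calc (\<lambda>t. complex_of_real (g t - f t)) a))"
    using le by (intro state_cfun_calc_nonneg a continuous_intros f g) simp
  also have "cfun_calc (\<lambda>t. complex_of_real (g t - f t)) a =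
      cfun_calc (\<lambda>t. complex_of_real (g t)) a - cfun_calc (\<lambda>t. complex_of_real (f t)) a"
    unfolding of_real_diff by (intro cfun_calc_diff a continuous_intros f g)
  finally show ?thesis by (simp add: state_diff[OF \<phi>])
qed

lemma state_self_adjoint_le_norm:
  assumes s: "adj s = s"
  shows "Re (\<phi> s) \<le> norm s"
proof -
  have "Re (\<phi> (cfun_calc complex_of_real s)) \<le> Re (\<phi> (cfun_calc (\<lambda>_. complex_of_real (norm s)) s))"
  proof (intro state_cfun_calc_mono s continuous_intros)
    fix t assume "t \<in> real_spectrum s"
    then show "t \<le> norm s" using real_spectrum_norm_le[of t s] by linarith
  qed
  then show ?thesis
    by (simp add: cfun_calc_ident[OF s] cfun_calc_const[OF s] state_scaleR[OF \<phi>] state_1[OF \<phi>])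
qed

lemma cmod_state_le: "cmod (\<phi> a) \<le> norm a"
proof -
  have "(cmod (\<phi> a))\<^sup>2 \<le> Re (\<phi> (adj a * a))"
    using state_Cauchy_Schwarz[of 1 a] by (simp add: state_1[OF \<phi>])
  also have "\<dots> \<le> norm (adj a * a)"
    by (rule state_self_adjoint_le_norm) (simp add: adj_mult adj_adj)
  finally have "(cmod (\<phi> a))\<^sup>2 \<le> (norm a)\<^sup>2" by (simp only: cstar_identity)
  then show ?thesis by (rule power2_le_imp_le) simp
qed

lemma bounded_linear_state: "bounded_linear \<phi>"
  by (rule bounded_linear_intro[of _ 1])
    (simp_all add: state_add[OF \<phi>] state_scaleR[OF \<phi>] cmod_state_le scaleR_conv_of_real[where 'a = complex])

section \<open>The spectral distribution\<close>

text \<open>Discrete approximations of the spectral distribution: since a Bernstein polynomial is nonnegative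
  on the spectrum (rescaled to \<open>[0, 1]\<close>), its value in the state is a weight at the corresponding node.\<close>

lemma bernstein_measures:
  assumes a: "adj a = a" and K: "norm a < K"
  obtains \<mu> where "\<And>n. real_distribution (\<mu> n)" "\<And>n. measure (\<mu> n) {- K - 1<..K} = 1"
    "\<And>n F. continuous_on UNIV F \<Longrightarrow> integral\<^sup>L (\<mu> n) F =
       Re (\<phi> (cfun_calc (\<lambda>t. complex_of_real
         (\<Sum>k\<le>n. F (2 * K * (k / n) - K) * Bernstein n k ((t + K) / (2 * K)))) a))"
proof -
  have K0: "K > 0" using K norm_ge_zero[of a] by linarith
  define B where "B n k t = Bernstein n k ((t + K) / (2 * K))" for n k and t :: real
  \<comment> \<open>The weights sum to 1 because the Bernstein polynomials of degree
    \<open>n\<close> form a partition of unity; the nodes \<open>x n k\<close> divide the interval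
    from \<open>- K\<close> to \<open>K\<close> evenly.\<close>
  define w where "w n k = Re (\<phi> (cfun_calc (\<lambda>t. complex_of_real (B n k t)) a))" for n k
  define x where "x n k = 2 * K * (real k / real n) - K" for n k :: nat
  define N where "N n = point_measure {..n} (\<lambda>k. ennreal (w n k))" for n
  define \<mu> where "\<mu> n = distr (N n) borel (x n)" for n
  have contB: "continuous_on S (B n k)" for S n k
    unfolding B_def[abs_def] Bernstein_def by (intro continuous_intros) (use K0 in auto)
  have w0: "0 \<le> w n k" for n k
    unfolding w_def
  proof (rule state_cfun_calc_nonneg[OF a contB])
    fix t assume "t \<in> real_spectrum a"
    then have "\<bar>t\<bar> \<le> K" using real_spectrum_norm_le[of t a] K by linarith
    then show "0 \<le> B n k t"
      unfolding B_def using K0 by (intro Bernstein_nonneg) (auto simp: field_simps)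
  qed
  have weighted: "(\<Sum>k\<le>n. w n k * c k) = Re (\<phi> (cfun_calc (\<lambda>t. complex_of_real (\<Sum>k\<le>n. c k * B n k t)) a))"
    for n c
  proof -
    have "cfun_calc (\<lambda>t. complex_of_real (\<Sum>k\<le>n. c k * B n k t)) a =
        (\<Sum>k\<le>n. complex_of_real (c k) *\<^sub>C cfun_calc (\<lambda>t. complex_of_real (B n k t)) a)"
      unfolding of_real_sum of_real_mult
      by (subst cfun_calc_sum[OF a])
        (auto intro!: continuous_intros contB sum.cong simp: cfun_calc_scaleC[OF a] continuous_on_of_real contB simp del: scaleC_of_real')
    then show ?thesis
      by (simp add: state_sum[OF \<phi>] state_scaleC[OF \<phi>] state_scaleR[OF \<phi>] w_def mult.commute)
  qed
  have w1: "(\<Sum>k\<le>n. w n k) = 1" for n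
    using weighted[of n "\<lambda>_. 1"]
    by (simp add: B_def cfun_calc_const[OF a, of 1, simplified] state_1[OF \<phi>])
  have prob: "prob_space (N n)" for n
    by (rule prob_spaceI)
      (simp add: N_def emeasure_point_measure_finite space_point_measure w0 w1 sum_ennreal)
  have meas: "x n \<in> borel_measurable (N n)" for n by (simp add: N_def)
  have 1: "real_distribution (\<mu> n)" for n
    unfolding \<mu>_def by (rule prob_space.real_distribution_distr[OF prob meas])
  \<comment> \<open>Tightness is phrased with intervals open on the left, hence the margin below the
    lowest node \<open>- K\<close>.\<close>
  have 2: "measure (\<mu> n) {- K - 1<..K} = 1" for n
  proof -
    have "x n k \<in> {- K - 1<..K}" if "k \<le> n" for k
    proof -
      have "0 \<le> real k / real n" "real k / real n \<le> 1" using that by (auto simp: divide_le_eq_1)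
      then have "0 \<le> 2 * K * (real k / real n)"
        using K0 by (intro mult_nonneg_nonneg) simp_all
      moreover have "2 * K * (real k / real n) \<le> 2 * K * 1"
        using K0 \<open>real k / real n \<le> 1\<close> by (intro mult_left_mono) simp_all
      ultimately show ?thesis by (simp add: x_def)
    qed
    then have "x n -` {- K - 1<..K} \<inter> space (N n) = space (N n)"
      by (auto simp: N_def space_point_measure)
    then show ?thesis
      unfolding \<mu>_def by (subst measure_distr[OF meas]) (simp_all add: prob_space.prob_space[OF prob])
  qed
  have 3: "integral\<^sup>L (\<mu> n) F =
       Re (\<phi> (cfun_calc (\<lambda>t. complex_of_real
         (\<Sum>k\<le>n. F (2 * K * (k / n) - K) * Bernstein n k ((t + K) / (2 * K)))) a))"
    if F: "continuous_on UNIV F" for n F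
  proof -
    have "integral\<^sup>L (\<mu> n) F = integral\<^sup>L (N n) (\<lambda>k. F (x n k))"
      unfolding \<mu>_def by (rule integral_distr[OF meas]) (rule borel_measurable_continuous_onI[OF F])
    also have "\<dots> = (\<Sum>k\<le>n. w n k * F (x n k))"
      unfolding N_def by (subst lebesgue_integral_point_measure_finite) (auto simp: w0)
    finally show ?thesis by (simp add: weighted B_def x_def)
  qed
  show ?thesis by (rule that[OF 1 2 3])
qed

text \<open>The Bernstein measures live on one bounded interval, hence are tight and have a weakly
  convergent subsequence. Their integrals of \<open>F\<close> are the state at Bernstein
  approximations of \<open>F\<close>, which converge by the Weierstrass theorem and continuity of
  the calculus and the state. This identifies the integrals against the weak limit.\<close>

lemma spectral_measure_exists:
  assumes a: "adj a = a"
  obtains M where "real_distribution M"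
    "\<And>F B. continuous_on UNIV F \<Longrightarrow> (\<And>t. \<bar>F t\<bar> \<le> B) \<Longrightarrow>
      integral\<^sup>L M F = Re (\<phi> (cfun_calc (\<lambda>t. complex_of_real (F t)) a))"
proof -
  define K where "K = norm a + 1"
  have K: "norm a < K" "K > 0" using norm_ge_zero[of a] unfolding K_def by linarith+
  obtain \<mu> where dist: "\<And>n. real_distribution (\<mu> n)" and supp: "\<And>n. measure (\<mu> n) {- K - 1<..K} = 1"
    and int: "\<And>n F. continuous_on UNIV F \<Longrightarrow> integral\<^sup>L (\<mu> n) F =
       Re (\<phi> (cfun_calc (\<lambda>t. complex_of_real
         (\<Sum>k\<le>n. F (2 * K * (k / n) - K) * Bernstein n k ((t + K) / (2 * K)))) a))"
    using bernstein_measures[OF a K(1)] by blast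
  have "tight \<mu>"
    unfolding tight_def
  proof (intro conjI allI impI dist)
    fix e :: real assume "e > 0"
    then show "\<exists>a b. a < b \<and> (\<forall>n. 1 - e < measure (\<mu> n) {a<..b})"
      using supp K by (intro exI[of _ "- K - 1"] exI[of _ K]) auto
  qed
  then obtain r M where r: "strict_mono r" and M: "real_distribution M"
    and conv: "weak_conv_m (\<mu> \<circ> id \<circ> r) M"
    using tight_imp_convergent_subsubsequence[of \<mu> id] by (auto simp: strict_mono_id)
  have "integral\<^sup>L M F = Re (\<phi> (cfun_calc (\<lambda>t. complex_of_real (F t)) a))"
    if F: "continuous_on UNIV F" "\<And>t. \<bar>F t\<bar> \<le> B" for F B
  proof -
    define P where "P n t = (\<Sum>k\<le>n. F (2 * K * (k / n) - K) * Bernstein n k ((t + K) / (2 * K)))" for n t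
    have contP: "continuous_on S (P n)" for S n
      unfolding P_def[abs_def] Bernstein_def by (intro continuous_intros) (use K in auto)
    have contF: "continuous_on S F" for S using F(1) continuous_on_subset by blast
    have "uniform_limit (real_spectrum a) (\<lambda>n t. complex_of_real (P n t)) (\<lambda>t. complex_of_real (F t)) sequentially"
    proof (rule uniform_limitI)
      fix e :: real assume e: "e > 0"
      have "continuous_on {0..1} (\<lambda>s. F (2 * K * s - K))"
        by (intro continuous_on_compose2[OF F(1)] continuous_intros) auto
      from Bernstein_Weierstrass[OF this e] obtain n0 where n0: "\<And>n s. n \<ge> n0 \<Longrightarrow> s \<in> {0..1} \<Longrightarrow>
          \<bar>F (2 * K * s - K) - (\<Sum>k\<le>n. F (2 * K * (k / n) - K) * Bernstein n k s)\<bar> < e" by blast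
      have "dist (complex_of_real (P n t)) (complex_of_real (F t)) < e"
        if "n \<ge> n0" "t \<in> real_spectrum a" for n t
      proof -
        have "\<bar>t\<bar> \<le> K" using real_spectrum_norm_le[OF that(2)] K by linarith
        then have "(t + K) / (2 * K) \<in> {0..1}" using K by (auto simp: field_simps)
        from n0[OF that(1) this] have "\<bar>F t - P n t\<bar> < e" using K(2) by (simp add: P_def)
        then show ?thesis by (simp only: dist_of_real dist_real_def abs_minus_commute)
      qed
      then show "\<forall>\<^sub>F n in sequentially. \<forall>t\<in>real_spectrum a. dist (complex_of_real (P n t)) (complex_of_real (F t)) < e"
        unfolding eventually_sequentially by blast
    qed
    then have "(\<lambda>n. cfun_calc (\<lambda>t. complex_of_real (P n t)) a) \<longlonglongrightarrow> cfun_calc (\<lambda>t. complex_of_real (F t)) a"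
      by (intro cfun_calc_uniform_limit a continuous_on_of_real contP contF)
    then have "(\<lambda>n. Re (\<phi> (cfun_calc (\<lambda>t. complex_of_real (P n t)) a))) \<longlonglongrightarrow>
        Re (\<phi> (cfun_calc (\<lambda>t. complex_of_real (F t)) a))"
      by (intro tendsto_Re bounded_linear.tendsto[OF bounded_linear_state])
    then have "(\<lambda>n. integral\<^sup>L (\<mu> n) F) \<longlonglongrightarrow> Re (\<phi> (cfun_calc (\<lambda>t. complex_of_real (F t)) a))"
      using int[OF F(1)] by (simp add: P_def)
    from LIMSEQ_subseq_LIMSEQ[OF this r]
    have "(\<lambda>n. integral\<^sup>L ((\<mu> \<circ> id \<circ> r) n) F) \<longlonglongrightarrow> Re (\<phi> (cfun_calc (\<lambda>t. complex_of_real (F t)) a))"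
      by (simp add: o_def)
    moreover have "(\<lambda>n. integral\<^sup>L ((\<mu> \<circ> id \<circ> r) n) F) \<longlonglongrightarrow> integral\<^sup>L M F"
      by (rule weak_conv_imp_integral_bdd_continuous_conv[OF _ M conv, of F B])
        (use dist F in \<open>auto simp: continuous_on_eq_continuous_at\<close>)
    ultimately show ?thesis using LIMSEQ_unique by blast
  qed
  with M show ?thesis by (rule that)
qed

text \<open>Two gaps remain after \<open>spectral_measure_exists\<close>. That the measure is
  concentrated on the spectrum is seen by integrating the truncated distance to it, a function that
  the calculus sends to 0. A function continuous only on the spectrum is handled by a bounded Tietze
  extension.\<close>

lemma is_spectral_distribution_exists:
  assumes a: "adj a = a"
  obtains M where "is_spectral_distribution \<phi> a M"
proof -
  let ?S = "real_spectrum a"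
  obtain M where M: "real_distribution M" and int: "\<And>F B. continuous_on UNIV F \<Longrightarrow> (\<And>t. \<bar>F t\<bar> \<le> B) \<Longrightarrow>
      integral\<^sup>L M F = Re (\<phi> (cfun_calc (\<lambda>t. complex_of_real (F t)) a))"
    using spectral_measure_exists[OF a] by blast
  interpret M: real_distribution M by (rule M)
  have S: "closed ?S" "?S \<noteq> {}"
    by (simp_all add: compact_imp_closed compact_real_spectrum real_spectrum_nonempty a)
  let ?d = "\<lambda>t. min 1 (infdist t ?S)"
  have d: "continuous_on UNIV ?d" by (intro continuous_intros)
  have [measurable]: "?d \<in> borel_measurable borel" by (rule borel_measurable_continuous_onI[OF d])
  have "integral\<^sup>L M ?d = Re (\<phi> (cfun_calc (\<lambda>t. complex_of_real (?d t)) a))"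
    by (rule int[OF d, of 1]) (simp add: infdist_nonneg abs_le_iff min_def)
  also have "cfun_calc (\<lambda>t. complex_of_real (?d t)) a = cfun_calc (\<lambda>_. 0) a"
    by (rule cfun_calc_cong) simp
  also have "Re (\<phi> \<dots>) = 0" by (simp add: cfun_calc_const[OF a] state_0[OF \<phi>])
  finally have "integral\<^sup>L M ?d = 0" .
  moreover have "integrable M ?d"
  proof (rule M.integrable_const_bound[of _ 1])
    show "?d \<in> borel_measurable M" by measurable
  qed (auto simp: infdist_nonneg min_def)
  ultimately have "AE t in M. ?d t = 0"
    by (subst (asm) integral_nonneg_eq_0_iff_AE) (auto simp: infdist_nonneg)
  then have AE: "AE t in M. t \<in> ?S"
    by eventually_elim (use S in \<open>auto simp: in_closed_iff_infdist_zero min_def split: if_splits\<close>)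
  then have "measure M ?S = 1" by (subst M.AE_in_set_eq_1[symmetric]) auto
  moreover have "\<phi> (cfun_calc f a) = (LINT t:?S|M. f t)" if f: "continuous_on ?S f" for f
  proof -
    have "bounded (f ` ?S)" by (intro compact_imp_bounded compact_continuous_image compact_real_spectrum f)
    then obtain B where B: "B > 0" "\<And>t. t \<in> ?S \<Longrightarrow> norm (f t) \<le> B" by (auto simp: bounded_pos)
    then obtain G where G: "continuous_on UNIV G" "\<And>t. t \<in> ?S \<Longrightarrow> G t = f t" "\<And>t. norm (G t) \<le> B"
      using Tietze[OF f, of UNIV B] S by (auto simp: less_imp_le)
    have contRe: "continuous_on T (\<lambda>t. Re (G t))" and contIm: "continuous_on T (\<lambda>t. Im (G t))" for T
      using G(1) by (auto intro!: continuous_intros intro: continuous_on_subset)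
    have Re: "integral\<^sup>L M (\<lambda>t. Re (G t)) = Re (\<phi> (cfun_calc (\<lambda>t. complex_of_real (Re (G t))) a))"
      by (rule int[OF contRe, of B]) (use G(3) abs_Re_le_cmod order.trans in blast)
    have Im: "integral\<^sup>L M (\<lambda>t. Im (G t)) = Re (\<phi> (cfun_calc (\<lambda>t. complex_of_real (Im (G t))) a))"
      by (rule int[OF contIm, of B]) (use G(3) abs_Im_le_cmod order.trans in blast)
    have [measurable]: "G \<in> borel_measurable borel" by (rule borel_measurable_continuous_onI[OF G(1)])
    have Gint: "integrable M G"
      by (rule M.integrable_const_bound[of _ B]) (auto simp: G(3))
    have "cfun_calc f a = cfun_calc (\<lambda>t. complex_of_real (Re (G t)) + \<i> * complex_of_real (Im (G t))) a"
      by (rule cfun_calc_cong) (simp add: G(2) flip: complex_eq)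
    also have "\<dots> = cfun_calc (\<lambda>t. complex_of_real (Re (G t))) a + \<i> *\<^sub>C cfun_calc (\<lambda>t. complex_of_real (Im (G t))) a"
      by (subst cfun_calc_add[OF a]) (auto intro!: continuous_intros contRe contIm continuous_on_of_real
          simp: cfun_calc_scaleC[OF a continuous_on_of_real[OF contIm]])
    finally have "\<phi> (cfun_calc f a) = of_real (integral\<^sup>L M (\<lambda>t. Re (G t))) + \<i> * of_real (integral\<^sup>L M (\<lambda>t. Im (G t)))"
      using state_cfun_calc_of_real[OF a contRe] state_cfun_calc_of_real[OF a contIm]
      by (simp add: state_add[OF \<phi>] state_scaleC[OF \<phi>] Re Im)
    also have "\<dots> = integral\<^sup>L M G"
      using Gint by (simp add: complex_eq_iff)
    also have "\<dots> = (LINT t:?S|M. G t)"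
      unfolding set_lebesgue_integral_def
      by (intro integral_cong_AE) (use AE in \<open>auto elim!: eventually_mono\<close>)
    also have "\<dots> = (LINT t:?S|M. f t)"
      by (rule set_lebesgue_integral_cong) (auto simp: G(2))
    finally show ?thesis .
  qed
  ultimately show ?thesis using M by (intro that) (auto simp: is_spectral_distribution_def)
qed

text \<open>The exponentials are among the continuous test functions, so the state determines the
  characteristic function, and this determines the measure.\<close>

lemma is_spectral_distribution_unique:
  assumes M: "is_spectral_distribution \<phi> a M" and N: "is_spectral_distribution \<phi> a N"
  shows "M = N"
proof (rule Levy_uniqueness)
  have char: "char L t = \<phi> (cfun_calc (\<lambda>x. iexp (t * x)) a)" if L: "is_spectral_distribution \<phi> a L" for L t
  proof -
    interpret L: real_distribution L using L by (simp add: is_spectral_distribution_def)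
    have "L.prob (real_spectrum a) = 1" using L by (simp add: is_spectral_distribution_def)
    then have AE: "AE x in L. x \<in> real_spectrum a" by (rule L.AE_prob_1)
    have "char L t = (LINT x:real_spectrum a|L. iexp (t * x))"
      unfolding char_def set_lebesgue_integral_def
      by (intro integral_cong_AE) (use AE in \<open>auto elim!: eventually_mono\<close>)
    also have "\<dots> = \<phi> (cfun_calc (\<lambda>x. iexp (t * x)) a)"
    proof -
      have "continuous_on (real_spectrum a) (\<lambda>x. iexp (t * x))" by (intro continuous_intros)
      then show ?thesis using L by (simp add: is_spectral_distribution_def)
    qed
    finally show ?thesis .
  qed
  show "char M = char N" using char[OF M] char[OF N] by auto
qed (use M N in \<open>auto simp: is_spectral_distribution_def\<close>)

lemma is_spectral_distribution:
  assumes "adj a = a"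
  shows "is_spectral_distribution \<phi> a (spectral_distribution \<phi> a)"
  unfolding spectral_distribution_def
  using is_spectral_distribution_exists[OF assms] is_spectral_distribution_unique by (metis theI')

lemma AE_spectral_distribution:
  assumes "adj a = a"
  shows "AE t in spectral_distribution \<phi> a. t \<in> real_spectrum a"
proof -
  have "real_distribution (spectral_distribution \<phi> a)"
    and 1: "measure (spectral_distribution \<phi> a) (real_spectrum a) = 1"
    using is_spectral_distribution[OF assms] by (auto simp: is_spectral_distribution_def)
  then interpret real_distribution "spectral_distribution \<phi> a" by simp
  show ?thesis by (rule AE_prob_1[OF 1])
qed

lemma state_poly_elem:
  assumes a: "adj a = a"
  shows "Re (\<phi> (poly_elem (map_poly of_real p) a)) = (LINT t|spectral_distribution \<phi> a. poly p t)"
proof -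
  let ?M = "spectral_distribution \<phi> a"
  have M: "real_distribution ?M" and int: "\<And>f. continuous_on (real_spectrum a) f \<Longrightarrow>
      \<phi> (cfun_calc f a) = (LINT t:real_spectrum a|?M. f t)"
    using is_spectral_distribution[OF a] by (auto simp: is_spectral_distribution_def)
  interpret M: real_distribution ?M by (rule M)
  have [measurable]: "(\<lambda>t. complex_of_real (poly p t)) \<in> borel_measurable borel"
    by (intro borel_measurable_continuous_onI continuous_intros)
  have "\<phi> (poly_elem (map_poly of_real p) a) = (LINT t:real_spectrum a|?M. complex_of_real (poly p t))"
    using int[of "\<lambda>t. complex_of_real (poly p t)"] cfun_calc_poly[OF a, of "map_poly of_real p"]
    by (simp add: continuous_on_of_real continuous_on_poly)
  also have "\<dots> = (LINT t|?M. complex_of_real (poly p t))"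
    unfolding set_lebesgue_integral_def
    by (intro integral_cong_AE) (use AE_spectral_distribution[OF a] in \<open>auto elim!: eventually_mono\<close>)
  also have "\<dots> = complex_of_real (LINT t|?M. poly p t)" by simp
  finally show ?thesis by simp
qed

end

section \<open>Polynomial approximation of a smoothed logarithm\<close>

lemma antiderivative_poly:
  obtains p :: "real poly" where "pderiv p = q" "poly p 0 = c"
proof -
  define r where "r = (\<Sum>i\<le>degree q. monom (coeff q i / of_nat (Suc i)) i)"
  have "coeff r n = coeff q n / of_nat (Suc n)" for n
    by (cases "n \<le> degree q") (simp_all add: r_def coeff_sum coeff_eq_0)
  then have "pderiv (pCons c r) = q"
    by (intro poly_eqI) (simp add: coeff_pderiv del: of_nat_Suc)
  then show ?thesis by (rule that) simp
qed

text \<open>Integrating a polynomial approximation of \<open>1 / (s + \<epsilon>)\<close> controls the derivative as well as the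
  values; the bound on \<open>s p'(s)\<close> is what the length estimate uses.\<close>

lemma poly_approx_ln:
  fixes K \<epsilon> \<delta> :: real
  assumes K: "K \<ge> 0" and \<epsilon>: "\<epsilon> > 0" and \<delta>: "\<delta> > 0"
  obtains p :: "real poly" where
    "\<And>s. s \<in> {0..K} \<Longrightarrow> \<bar>poly p s - ln (s + \<epsilon>)\<bar> \<le> \<delta>"
    "\<And>s. s \<in> {0..K} \<Longrightarrow> \<bar>poly (pderiv p) s * s\<bar> \<le> 1 + \<delta>"
proof -
  \<comment> \<open>The tolerance for the derivative: integrated over a length of at most
    \<open>K\<close> it contributes at most \<delta>. The summand 1 covers
    \<open>K = 0\<close>.\<close>
  define \<eta> where "\<eta> = \<delta> / (K + 1)"
  have \<eta>: "\<eta> > 0" and \<eta>K: "\<eta> * s \<le> \<delta>" if "s \<in> {0..K}" for s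
  proof -
    show "\<eta> > 0" using K \<delta> by (simp add: \<eta>_def)
    have "\<delta> * s \<le> \<delta> * (K + 1)" using that \<delta> by (intro mult_left_mono) auto
    then show "\<eta> * s \<le> \<delta>" using K by (simp add: \<eta>_def field_simps)
  qed
  have \<eta>0: "\<eta> > 0" using \<eta>[of 0] K by simp
  have cont: "continuous_on {0..K} (\<lambda>s. 1 / (s + \<epsilon>))" using \<epsilon> by (intro continuous_intros) auto
  obtain q where q: "\<And>s. s \<in> {0..K} \<Longrightarrow> \<bar>1 / (s + \<epsilon>) - poly q s\<bar> < \<eta>"
    using real_polynomial_approximation[OF compact_Icc cont \<eta>0] by blast
  obtain p where p: "pderiv p = q" "poly p 0 = ln \<epsilon>" using antiderivative_poly by blast
  have "\<bar>poly p s - ln (s + \<epsilon>)\<bar> \<le> \<delta>" if s: "s \<in> {0..K}" for s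
  proof -
    have "norm ((poly p s - ln (s + \<epsilon>)) - (poly p 0 - ln (0 + \<epsilon>))) \<le> \<eta> * norm (s - 0)"
    proof (rule field_differentiable_bound[of "{0..K}" _ "\<lambda>s. poly q s - 1 / (s + \<epsilon>)"])
      fix z assume z: "z \<in> {0..K}"
      show "((\<lambda>s. poly p s - ln (s + \<epsilon>)) has_field_derivative poly q z - 1 / (z + \<epsilon>)) (at z within {0..K})"
        using z \<epsilon> by (auto intro!: derivative_eq_intros poly_DERIV[THEN has_field_derivative_at_within] simp: p)
      show "norm (poly q z - 1 / (z + \<epsilon>)) \<le> \<eta>" using q[OF z] by (simp add: abs_minus_commute)
    qed (use s K in auto)
    with \<eta>K[OF s] s p(2) show ?thesis by simp
  qed
  moreover have "\<bar>poly (pderiv p) s * s\<bar> \<le> 1 + \<delta>" if s: "s \<in> {0..K}" for s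
  proof -
    \<comment> \<open>The main term \<open>s / (s + \<epsilon>)\<close> is at most 1 whatever
      \<epsilon> is; this is where the bound becomes independent of \<epsilon>.\<close>
    have "\<bar>poly q s * s\<bar> = \<bar>s / (s + \<epsilon>) - (1 / (s + \<epsilon>) - poly q s) * s\<bar>"
      by (simp add: algebra_simps)
    also have "\<dots> \<le> \<bar>s / (s + \<epsilon>)\<bar> + \<bar>1 / (s + \<epsilon>) - poly q s\<bar> * s"
      using s abs_triangle_ineq4[of "s / (s + \<epsilon>)" "(1 / (s + \<epsilon>) - poly q s) * s"] by (simp add: abs_mult)
    also have "\<dots> \<le> 1 + \<eta> * s"
      using s \<epsilon> q[OF s] by (intro add_mono mult_right_mono) auto
    finally show ?thesis using \<eta>K[OF s] by (simp add: p(1))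
  qed
  ultimately show ?thesis by (rule that)
qed

lemma pderiv_map_poly_of_real:
  "pderiv (map_poly complex_of_real p) = map_poly complex_of_real (pderiv p)"
  by (rule poly_eqI) (simp add: coeff_pderiv coeff_map_poly)

lemma commutes_poly_elem:
  assumes "g * h = h * (g::'a::cstar_algebra)"
  shows "g * poly_elem p h = poly_elem p h * g"
proof (induction p)
  case (pCons c p)
  have "g * (h * poly_elem p h) = h * (g * poly_elem p h)" by (simp add: assms flip: mult.assoc)
  with pCons show ?case
    by (simp add: distrib_left distrib_right mult_scaleC_left mult_scaleC_right mult.assoc)
qed simp

lemma norm_alg_abs:
  assumes "faithful_tracial_state (\<phi> :: 'a::cstar_algebra \<Rightarrow> complex)"
  shows "norm (alg_abs (x::'a)) = norm x"
proof -
  have "adj (alg_abs x) = alg_abs x"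
    using positive_alg_abs[OF assms, of x] by (simp add: positive_element_def)
  then have "(norm (alg_abs x))\<^sup>2 = (norm x)\<^sup>2"
    using cstar_identity[of "alg_abs x"] cstar_identity[of x] by (simp add: alg_abs_square[OF assms])
  then show ?thesis by (simp add: power2_eq_iff_nonneg)
qed

lemma real_spectrum_adj_mult:
  assumes "faithful_tracial_state (\<phi> :: 'a::cstar_algebra \<Rightarrow> complex)"
    and "(norm x)\<^sup>2 \<le> K" and "s \<in> real_spectrum (adj x * (x::'a))"
  shows "s \<in> {0..K}"
  using positive_element_real_spectrum_nonneg[OF positive_element_adj_mult[OF assms(1)] assms(3)]
    real_spectrum_norm_le[OF assms(3)] assms(2) by (simp add: cstar_identity)

section \<open>The smoothed logarithmic determinant\<close>

text \<open>This is \<open>\<phi> (log (x\<^sup>* x + \<epsilon>)) / 2\<close>, which decreases to the logarithm of the Fuglede--Kadison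
  determinant as \<open>\<epsilon>\<close> tends to 0 but is continuous in \<open>x\<close>.\<close>

definition smoothed_logdet :: "('a::cstar_algebra \<Rightarrow> complex) \<Rightarrow> real \<Rightarrow> 'a \<Rightarrow> real" where
  "smoothed_logdet \<phi> \<epsilon> x = (LINT t|spectral_distribution \<phi> (alg_abs x). ln (t\<^sup>2 + \<epsilon>)) / 2"

context
  fixes \<phi> :: "'a::cstar_algebra \<Rightarrow> complex"
  assumes \<phi>: "faithful_tracial_state \<phi>"
begin

lemma self_adjoint_alg_abs: "adj (alg_abs x) = alg_abs (x::'a)"
  using positive_alg_abs[OF \<phi>, of x] by (simp add: positive_element_def)

lemma real_distribution_alg_abs: "real_distribution (spectral_distribution \<phi> (alg_abs x))"
  using is_spectral_distribution[OF \<phi> self_adjoint_alg_abs[of x]] by (simp add: is_spectral_distribution_def)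

lemma AE_spectral_distribution_alg_abs:
  "AE t in spectral_distribution \<phi> (alg_abs x). t \<in> {0..norm x}"
  using AE_spectral_distribution[OF \<phi> self_adjoint_alg_abs[of x]]
proof eventually_elim
  case (elim t)
  then show ?case
    using positive_element_real_spectrum_nonneg[OF positive_alg_abs[OF \<phi>] elim]
      real_spectrum_norm_le[OF elim] by (simp add: norm_alg_abs[OF \<phi>])
qed

text \<open>The bridge between the analytic and the algebraic side: the integral defines the
  smoothed determinant, while the state of a polynomial can be differentiated in \<open>x\<close>.
  It holds since \<open>adj x * x\<close> is the square of \<open>alg_abs x\<close>.\<close>

lemma state_poly_elem_adj_mult:
  "Re (\<phi> (poly_elem (map_poly of_real p) (adj x * x))) =
    (LINT t|spectral_distribution \<phi> (alg_abs x). poly p (t\<^sup>2))"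
proof -
  let ?b = "alg_abs x"
  have "poly_elem (map_poly of_real p) (adj x * x) = poly_elem (pcompose (map_poly of_real p) [:0, 0, 1:]) ?b"
    by (simp add: poly_elem_pcompose alg_abs_square[OF \<phi>])
  \<comment> \<open>The detour through \<open>cfun_calc\<close> makes it enough to compare the two
    polynomials by their values at real points.\<close>
  also have "\<dots> = cfun_calc (\<lambda>t. poly (pcompose (map_poly of_real p) [:0, 0, 1:]) (complex_of_real t)) ?b"
    by (rule cfun_calc_poly[symmetric, OF self_adjoint_alg_abs])
  also have "(\<lambda>t. poly (pcompose (map_poly of_real p) [:0, 0, 1:]) (complex_of_real t)) =
      (\<lambda>t. poly (map_poly of_real (pcompose p [:0, 0, 1:])) (complex_of_real t))"
    by (simp add: poly_pcompose flip: of_real_mult)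
  also have "cfun_calc \<dots> ?b = poly_elem (map_poly of_real (pcompose p [:0, 0, 1:])) ?b"
    by (rule cfun_calc_poly[OF self_adjoint_alg_abs])
  finally show ?thesis
    by (simp add: state_poly_elem[OF \<phi> self_adjoint_alg_abs] poly_pcompose power2_eq_square)
qed

lemma integrable_ln_alg_abs:
  assumes "\<epsilon> > 0"
  shows "integrable (spectral_distribution \<phi> (alg_abs x)) (\<lambda>t. ln (t\<^sup>2 + \<epsilon>))"
proof -
  interpret real_distribution "spectral_distribution \<phi> (alg_abs x)" by (rule real_distribution_alg_abs)
  show ?thesis
  proof (rule integrable_const_bound[of _ "max \<bar>ln \<epsilon>\<bar> \<bar>ln ((norm x)\<^sup>2 + \<epsilon>)\<bar>"])
    show "AE t in spectral_distribution \<phi> (alg_abs x).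
        norm (ln (t\<^sup>2 + \<epsilon>)) \<le> max \<bar>ln \<epsilon>\<bar> \<bar>ln ((norm x)\<^sup>2 + \<epsilon>)\<bar>"
      using AE_spectral_distribution_alg_abs[of x]
    proof eventually_elim
      case (elim t)
      then have "t\<^sup>2 \<le> (norm x)\<^sup>2" by (intro power_mono) auto
      with assms have "ln \<epsilon> \<le> ln (t\<^sup>2 + \<epsilon>)" "ln (t\<^sup>2 + \<epsilon>) \<le> ln ((norm x)\<^sup>2 + \<epsilon>)"
        by (simp_all add: add_nonneg_pos)
      then show ?case by simp
    qed
  qed simp
qed

text \<open>\<open>K\<close> is any bound for the squared norm, so a single \<open>p\<close> can
  serve for all points of a path or all members of a bounded sequence.\<close>

lemma smoothed_logdet_approx:
  assumes \<epsilon>: "\<epsilon> > 0" and K: "(norm x)\<^sup>2 \<le> K"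
    and p: "\<And>s. s \<in> {0..K} \<Longrightarrow> \<bar>poly p s - ln (s + \<epsilon>)\<bar> \<le> \<delta>"
  shows "\<bar>smoothed_logdet \<phi> \<epsilon> x - Re (\<phi> (poly_elem (map_poly of_real p) (adj x * x))) / 2\<bar> \<le> \<delta> / 2"
proof -
  let ?M = "spectral_distribution \<phi> (alg_abs x)"
  interpret real_distribution ?M by (rule real_distribution_alg_abs)
  have AE: "AE t in ?M. \<bar>ln (t\<^sup>2 + \<epsilon>) - poly p (t\<^sup>2)\<bar> \<le> \<delta>"
    using AE_spectral_distribution_alg_abs[of x]
  proof eventually_elim
    case (elim t)
    then have "t\<^sup>2 \<le> (norm x)\<^sup>2" by (intro power_mono) auto
    then show ?case using p[of "t\<^sup>2"] K by (simp add: abs_minus_commute)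
  qed
  have meas: "(\<lambda>t. poly p (t\<^sup>2)) \<in> borel_measurable borel"
    by (intro borel_measurable_continuous_onI continuous_intros)
  have int_diff: "integrable ?M (\<lambda>t. ln (t\<^sup>2 + \<epsilon>) - poly p (t\<^sup>2))"
    by (rule integrable_const_bound[of _ \<delta>]) (use AE meas in auto)
  then have int_p: "integrable ?M (\<lambda>t. poly p (t\<^sup>2))"
    using Bochner_Integration.integrable_diff[OF integrable_ln_alg_abs[OF \<epsilon>, of x] int_diff] by simp
  have "\<bar>LINT t|?M. ln (t\<^sup>2 + \<epsilon>) - poly p (t\<^sup>2)\<bar> \<le> (LINT t|?M. \<bar>ln (t\<^sup>2 + \<epsilon>) - poly p (t\<^sup>2)\<bar>)"
    by (rule integral_abs_bound)
  also have "\<dots> \<le> (LINT t|?M. \<delta>)"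
    using int_diff AE by (intro integral_mono_AE) auto
  also have "\<dots> = \<delta>" using prob_space by simp
  finally have "\<bar>(LINT t|?M. ln (t\<^sup>2 + \<epsilon>)) - (LINT t|?M. poly p (t\<^sup>2))\<bar> \<le> \<delta>"
    using integrable_ln_alg_abs[OF \<epsilon>, of x] int_p by simp
  then show ?thesis
    unfolding smoothed_logdet_def state_poly_elem_adj_mult by linarith
qed

text \<open>The spectral distributions vary with \<open>x\<close> and are not compared directly. A
  convergent sequence is bounded, so one polynomial approximates the logarithm for all its members
  and the limit, and the state of a polynomial in \<open>adj x * x\<close> is continuous in
  \<open>x\<close>.\<close>

lemma tendsto_smoothed_logdet:
  assumes \<epsilon>: "\<epsilon> > 0" and x: "x \<longlonglongrightarrow> y"
  shows "(\<lambda>n. smoothed_logdet \<phi> \<epsilon> (x n)) \<longlonglongrightarrow> smoothed_logdet \<phi> \<epsilon> y"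
proof (rule tendstoI)
  fix e :: real assume e: "e > 0"
  have "bounded (range x)" using x by (intro convergent_imp_bounded)
  then obtain R where R: "\<And>n. norm (x n) \<le> R" by (auto simp: bounded_iff)
  have Ry: "norm y \<le> R" using R by (intro Lim_norm_ubound[OF _ x]) auto
  define K where "K = R\<^sup>2"
  obtain p where p: "\<And>s. s \<in> {0..K} \<Longrightarrow> \<bar>poly p s - ln (s + \<epsilon>)\<bar> \<le> e / 2"
  proof -
    have "K \<ge> 0" "e / 2 > 0" using e by (simp_all add: K_def)
    then show thesis using poly_approx_ln[OF _ \<epsilon>] that by metis
  qed
  let ?L = "\<lambda>x. Re (\<phi> (poly_elem (map_poly of_real p) (adj x * x))) / 2"
  have "(\<lambda>n. ?L (x n)) \<longlonglongrightarrow> ?L y"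
    by (intro tendsto_intros bounded_linear.tendsto[OF bounded_linear_state[OF \<phi>]] tendsto_poly_elem tendsto_adj x) simp
  then have "\<forall>\<^sub>F n in sequentially. dist (?L (x n)) (?L y) < e / 2" using e by (intro tendstoD) auto
  then show "\<forall>\<^sub>F n in sequentially. dist (smoothed_logdet \<phi> \<epsilon> (x n)) (smoothed_logdet \<phi> \<epsilon> y) < e"
  proof eventually_elim
    case (elim n)
    have "(norm (x n))\<^sup>2 \<le> K" "(norm y)\<^sup>2 \<le> K" using R Ry by (auto simp: K_def intro!: power_mono)
    from smoothed_logdet_approx[OF \<epsilon> this(1) p] smoothed_logdet_approx[OF \<epsilon> this(2) p] elim
    show ?case unfolding dist_real_def by linarith
  qed
qed

text \<open>\<open>C\<close> does not depend on \<epsilon>: by invertibility the spectrum of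
  \<open>alg_abs x\<close> has a smallest element \<open>d > 0\<close>, and \<open>ln d\<close> is a
  lower bound for every \<epsilon>.\<close>

lemma smoothed_logdet_lower_bound:
  assumes x: "alg_invertible x"
  obtains C where "\<And>\<epsilon>. \<epsilon> > 0 \<Longrightarrow> C \<le> smoothed_logdet \<phi> \<epsilon> x"
proof -
  let ?b = "alg_abs x" and ?M = "spectral_distribution \<phi> (alg_abs x)"
  interpret real_distribution ?M by (rule real_distribution_alg_abs)
  have "alg_invertible (?b * ?b)"
    unfolding alg_abs_square[OF \<phi>] by (intro alg_invertible_mult alg_invertible_adj x)
  then have "alg_invertible ?b" using alg_invertible_factor by blast
  then have 0: "0 \<notin> real_spectrum ?b" by (simp add: real_spectrum_def spectrum_def)
  obtain d where d: "d \<in> real_spectrum ?b" "\<And>t. t \<in> real_spectrum ?b \<Longrightarrow> d \<le> t"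
    using compact_attains_inf[OF compact_real_spectrum real_spectrum_nonempty[OF self_adjoint_alg_abs]] by blast
  have "d > 0"
    using positive_element_real_spectrum_nonneg[OF positive_alg_abs[OF \<phi>] d(1)] 0 d(1)
    by (cases "d = 0") auto
  have "ln d \<le> smoothed_logdet \<phi> \<epsilon> x" if \<epsilon>: "\<epsilon> > 0" for \<epsilon>
  proof -
    have "AE t in ?M. 2 * ln d \<le> ln (t\<^sup>2 + \<epsilon>)"
      using AE_spectral_distribution[OF \<phi> self_adjoint_alg_abs[of x]]
    proof eventually_elim
      case (elim t)
      have "d\<^sup>2 \<le> t\<^sup>2" using d(2)[OF elim] \<open>d > 0\<close> by (intro power_mono) auto
      then have "ln (d\<^sup>2) \<le> ln (t\<^sup>2 + \<epsilon>)" using \<open>d > 0\<close> \<epsilon> by (intro ln_mono) auto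
      then show ?case using \<open>d > 0\<close> by (simp add: ln_realpow)
    qed
    then have "(LINT t|?M. 2 * ln d) \<le> (LINT t|?M. ln (t\<^sup>2 + \<epsilon>))"
      using integrable_ln_alg_abs[OF \<epsilon>, of x] by (intro integral_mono_AE) auto
    then show ?thesis using prob_space by (simp add: smoothed_logdet_def)
  qed
  then show ?thesis by (rule that)
qed

section \<open>Differentiating along a path\<close>

text \<open>The trace property makes the derivative of \<open>\<phi> (p (h))\<close> equal to \<open>\<phi> (p'(h) h')\<close> although \<open>h\<close> and
  \<open>h'\<close> need not commute. The factor \<open>g\<close> is there for the induction.\<close>

lemma state_poly_elem_derivative:
  assumes h: "(h has_vector_derivative h') (at t within T)"
  obtains D where "((\<lambda>t. poly_elem p (h t)) has_vector_derivative D) (at t within T)"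
    "\<And>g. g * h t = h t * g \<Longrightarrow> \<phi> (g * D) = \<phi> (g * poly_elem (pderiv p) (h t) * h')"
proof -
  have "\<exists>D. ((\<lambda>t. poly_elem p (h t)) has_vector_derivative D) (at t within T) \<and>
    (\<forall>g. g * h t = h t * g \<longrightarrow> \<phi> (g * D) = \<phi> (g * poly_elem (pderiv p) (h t) * h'))"
  proof (induction p)
    case 0
    show ?case by (auto intro!: exI[of _ 0] simp: has_vector_derivative_const)
  next
    case (pCons c p)
    then obtain D where D: "((\<lambda>t. poly_elem p (h t)) has_vector_derivative D) (at t within T)"
      "\<And>g. g * h t = h t * g \<Longrightarrow> \<phi> (g * D) = \<phi> (g * poly_elem (pderiv p) (h t) * h')" by blast
    let ?P = "poly_elem p (h t)"
    have "((\<lambda>t. poly_elem (pCons c p) (h t)) has_vector_derivative 0 + (h t * D + h' * ?P)) (at t within T)"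
      unfolding poly_elem_pCons
      by (intro has_vector_derivative_add has_vector_derivative_const has_vector_derivative_mult h D)
    moreover have "\<phi> (g * (0 + (h t * D + h' * ?P))) = \<phi> (g * poly_elem (pderiv (pCons c p)) (h t) * h')"
      if g: "g * h t = h t * g" for g
    proof -
      \<comment> \<open>The product rule leaves \<open>h t\<close> in front of \<open>D\<close>; it
        is absorbed into \<open>g\<close>, and the product still commutes with \<open>h t\<close>,
        so the induction hypothesis applies.\<close>
      have "(g * h t) * h t = h t * (g * h t)" using g by (metis mult.assoc)
      then have "\<phi> ((g * h t) * D) = \<phi> (g * h t * poly_elem (pderiv p) (h t) * h')" by (rule D(2))
      moreover have "\<phi> (g * h' * ?P) = \<phi> (g * ?P * h')"
        using commutes_poly_elem[OF g, of p] state_trace[OF \<phi>, of "g * h'" ?P] by (simp add: mult.assoc)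
      ultimately show ?thesis
        by (simp add: pderiv_pCons poly_elem_add distrib_left distrib_right state_add[OF \<phi>] mult.assoc add.commute)
    qed
    ultimately show ?case by blast
  qed
  then show ?thesis using that by blast
qed

text \<open>The derivative of \<open>adj (x t) * x t\<close> has two terms. Since \<open>p\<close>
  is real, \<open>?w\<close> is self-adjoint, and the trace property makes the contributions of the
  two terms complex conjugates; their sum is twice a real part, which cancels the division by
  2.\<close>

lemma state_poly_elem_adj_mult_derivative:
  assumes x: "(x has_vector_derivative x') (at t within T)"
  shows "((\<lambda>t. Re (\<phi> (poly_elem (map_poly of_real p) (adj (x t) * x t))) / 2) has_vector_derivative
    Re (\<phi> (poly_elem (map_poly of_real (pderiv p)) (adj (x t) * x t) * (adj (x t) * x')))) (at t within T)"
proof -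
  let ?h = "\<lambda>t. adj (x t) * x t"
  let ?w = "poly_elem (map_poly of_real (pderiv p)) (?h t)"
  have h: "(?h has_vector_derivative adj (x t) * x' + adj x' * x t) (at t within T)"
    by (intro has_vector_derivative_mult bounded_linear.has_vector_derivative[OF bounded_linear_adj] x)
  obtain D where D: "((\<lambda>t. poly_elem (map_poly of_real p) (?h t)) has_vector_derivative D) (at t within T)"
    "\<And>g. g * ?h t = ?h t * g \<Longrightarrow> \<phi> (g * D) =
      \<phi> (g * poly_elem (pderiv (map_poly of_real p)) (?h t) * (adj (x t) * x' + adj x' * x t))"
    by (rule state_poly_elem_derivative[OF h]) blast
  have sa: "adj ?w = ?w" by (intro adj_poly_elem_of_real) (simp add: adj_mult adj_adj)
  have "\<phi> (?w * (adj x' * x t)) = \<phi> (adj x' * x t * ?w)" by (rule state_trace[OF \<phi>])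
  also have "adj x' * x t * ?w = adj (?w * (adj (x t) * x'))"
    by (simp add: adj_mult adj_adj sa)
  also have "\<phi> \<dots> = cnj (\<phi> (?w * (adj (x t) * x')))" by (rule state_adj[OF \<phi>])
  finally have "\<phi> D = \<phi> (?w * (adj (x t) * x')) + cnj (\<phi> (?w * (adj (x t) * x')))"
    using D(2)[of 1] by (simp add: pderiv_map_poly_of_real distrib_left state_add[OF \<phi>])
  then have "Re (\<phi> D) / 2 = Re (\<phi> (?w * (adj (x t) * x')))" by simp
  moreover have "bounded_linear (\<lambda>y. Re (\<phi> y) / 2)"
    by (intro bounded_linear_compose[OF bounded_linear_divide] bounded_linear_compose[OF bounded_linear_Re]
        bounded_linear_state[OF \<phi>])
  from bounded_linear.has_vector_derivative[OF this D(1)]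
  have "((\<lambda>t. Re (\<phi> (poly_elem (map_poly of_real p) (?h t))) / 2) has_vector_derivative Re (\<phi> D) / 2) (at t within T)" .
  ultimately show ?thesis by simp
qed

text \<open>Writing \<open>x\<^sup>* x' = (x\<^sup>* x) (x\<^sup>-\<^sup>1 x')\<close> brings in the speed of the metric.\<close>

lemma state_derivative_bound:
  assumes x: "alg_invertible x" and K: "(norm x)\<^sup>2 \<le> K"
    and p: "\<And>s. s \<in> {0..K} \<Longrightarrow> \<bar>poly (pderiv p) s * s\<bar> \<le> B"
  shows "\<bar>Re (\<phi> (poly_elem (map_poly of_real (pderiv p)) (adj x * x) * (adj x * x')))\<bar>
    \<le> B * sqrt (Re (\<phi> (adj (alg_inverse x * x') * (alg_inverse x * x'))))"
proof -
  let ?h = "adj x * x" and ?P = "map_poly complex_of_real (pderiv p)"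
  let ?y = "alg_inverse x * x'" and ?u = "poly_elem (?P * [:0, 1:]) (adj x * x)"
  have B: "B \<ge> 0" using p[of 0] K by (metis abs_ge_zero atLeastAtMost_iff order.refl order.trans zero_le_power2)
  have sa: "adj ?h = ?h" by (simp add: adj_mult adj_adj)
  have u: "?u = poly_elem ?P ?h * ?h" by (subst poly_elem_mult) simp
  have "adj ?u = ?h * poly_elem ?P ?h"
    unfolding u by (simp only: adj_mult[of "poly_elem ?P ?h" ?h] sa adj_poly_elem_of_real[OF sa])
  also have "\<dots> = ?u" unfolding u by (rule commutes_poly_elem[of "?h" "?h", OF refl])
  finally have "adj ?u = ?u" .
  have "?u * ?y = poly_elem ?P ?h * (adj x * x')"
    unfolding u using alg_inverse_right[OF x] by (metis mult.assoc mult_1)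
  then have "(cmod (\<phi> (poly_elem ?P ?h * (adj x * x'))))\<^sup>2 \<le> Re (\<phi> (adj ?u * ?u)) * Re (\<phi> (adj ?y * ?y))"
    using state_Cauchy_Schwarz[OF \<phi>, of ?u ?y] \<open>adj ?u = ?u\<close> by simp
  also have "\<dots> \<le> B\<^sup>2 * Re (\<phi> (adj ?y * ?y))"
  proof (rule mult_right_mono)
    \<comment> \<open>\<open>?u\<close> is the function \<open>poly (pderiv p) s * s\<close> of
      \<open>adj x * x\<close>, so its norm is controlled by the supremum over a spectrum contained
      in \<open>{0..K}\<close>.\<close>
    have "norm ?u \<le> B"
    proof (rule norm_poly_elem_le[OF sa])
      fix s assume "s \<in> real_spectrum ?h"
      then have "s \<in> {0..K}" by (rule real_spectrum_adj_mult[OF \<phi> K])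
      then show "cmod (poly (?P * [:0, 1:]) (complex_of_real s)) \<le> B"
        using p[of s] by (simp add: norm_mult abs_mult mult.commute)
    qed
    then have "(norm ?u)\<^sup>2 \<le> B\<^sup>2" by (intro power_mono) auto
    moreover have "Re (\<phi> (adj ?u * ?u)) \<le> norm (adj ?u * ?u)"
      using cmod_state_le[OF \<phi>, of "adj ?u * ?u"] complex_Re_le_cmod order.trans by blast
    ultimately show "Re (\<phi> (adj ?u * ?u)) \<le> B\<^sup>2" by (simp add: cstar_identity)
    show "0 \<le> Re (\<phi> (adj ?y * ?y))"
      using state_nonneg[OF \<phi>, of ?y] by (simp add: complex_nonneg_Reals_iff)
  qed
  finally have "cmod (\<phi> (poly_elem ?P ?h * (adj x * x'))) \<le> sqrt (B\<^sup>2 * Re (\<phi> (adj ?y * ?y)))"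
    by (rule real_le_rsqrt)
  also have "\<dots> = B * sqrt (Re (\<phi> (adj ?y * ?y)))" using B by (simp add: real_sqrt_mult)
  finally show ?thesis using abs_Re_le_cmod order.trans by blast
qed

end

text \<open>The derivative may be unbounded near the points of \<open>S\<close>. The fundamental
  theorem still holds for the gauge integral, and a finite right-hand side makes the derivative
  Lebesgue integrable, so that both integrals agree. An infinite right-hand side makes the claim
  trivial.\<close>

lemma nn_integral_derivative_bound:
  fixes \<psi> \<psi>' g :: "real \<Rightarrow> real"
  assumes S: "finite S" and cont: "continuous_on {0..1} \<psi>"
    and deriv: "\<And>t. t \<in> {0<..<1} - S \<Longrightarrow> (\<psi> has_vector_derivative \<psi>' t) (at t)"
    and cont': "continuous_on ({0<..<1} - S) \<psi>'"
    and le: "\<And>t. t \<in> {0<..<1} - S \<Longrightarrow> \<bar>\<psi>' t\<bar> \<le> g t"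
  shows "ennreal \<bar>\<psi> 1 - \<psi> 0\<bar> \<le> (\<integral>\<^sup>+t\<in>{0..1}. ennreal (g t) \<partial>lborel)"
proof -
  let ?T = "{0<..<1} - S"
  define f where "f t = indicator ?T t *\<^sub>R \<psi>' t" for t
  have f: "f \<in> borel_measurable borel"
    unfolding f_def[abs_def] using cont' S
    by (intro borel_measurable_continuous_on_indicator) (auto intro!: borel_open open_Diff finite_imp_closed)
  have le': "(\<integral>\<^sup>+t. ennreal (norm (f t)) \<partial>lborel) \<le> (\<integral>\<^sup>+t\<in>{0..1}. ennreal (g t) \<partial>lborel)"
    by (rule nn_integral_mono) (auto simp: f_def indicator_def intro!: ennreal_leI le)
  show ?thesis
  proof (cases "(\<integral>\<^sup>+t. ennreal (norm (f t)) \<partial>lborel) = \<infinity>")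
    case True
    with le' show ?thesis by (simp add: top_unique)
  next
    case False
    then have int: "integrable lborel f"
      using f by (intro integrableI_bounded) (auto simp: top.not_eq_extremum)
    have "(\<psi>' has_integral (\<psi> 1 - \<psi> 0)) {0..1}"
      by (rule fundamental_theorem_of_calculus_interior_strong[OF S _ deriv cont]) auto
    then have "((\<lambda>t. if t \<in> {0..1} then \<psi>' t else 0) has_integral (\<psi> 1 - \<psi> 0)) UNIV"
      by (simp only: has_integral_restrict_UNIV)
    then have "(f has_integral (\<psi> 1 - \<psi> 0)) UNIV"
      by (rule has_integral_spike_finite[of "S \<union> {0, 1}", rotated 2])
        (use S in \<open>auto simp: f_def indicator_def\<close>)
    then have "\<psi> 1 - \<psi> 0 = integral\<^sup>L lborel f"
      using has_integral_integral_lborel[OF int] has_integral_unique by blast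
    then show ?thesis
      using order.trans[OF integral_norm_bound_ennreal[OF int] le'] by simp
  qed
qed

section \<open>The smoothed determinant along a path in the projective resolvent set\<close>

lemma bounded_linear_pencil: "bounded_linear (pencil (A :: 'a::cstar_algebra ^ 'n))"
  unfolding pencil_def[abs_def]
  by (rule bounded_linear_sum) (rule bounded_linear_compose[OF scaleC.bounded_linear_left bounded_linear_vec_nth])

text \<open>The Hermitian form of the metric is the squared norm of
  \<open>alg_inverse (pencil A (\<gamma> t)) * pencil A v\<close> for the inner product given by the
  state; this is the factor that Cauchy--Schwarz produces.\<close>

lemma path_speed_eq:
  assumes \<phi>: "faithful_tracial_state (\<phi> :: 'a::cstar_algebra \<Rightarrow> complex)"
    and v: "(\<gamma> has_vector_derivative v) (at t)"
  shows "path_speed \<phi> A \<gamma> t = sqrt (Re (\<phi> (adj (alg_inverse (pencil A (\<gamma> t)) * pencil A v) *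
    (alg_inverse (pencil A (\<gamma> t)) * pencil A v))))"
proof -
  let ?c = "alg_inverse (pencil A (\<gamma> t))"
  have "?c * pencil A v = (\<Sum>i\<in>UNIV. (v $ i) *\<^sub>C (?c * A $ i))"
    by (simp add: pencil_def sum_distrib_left mult_scaleC_right)
  then have "adj (?c * pencil A v) * (?c * pencil A v) =
      (\<Sum>j\<in>UNIV. cnj (v $ j) *\<^sub>C adj (?c * A $ j)) * (\<Sum>i\<in>UNIV. (v $ i) *\<^sub>C (?c * A $ i))"
    by (simp only: adj_sum adj_scaleC)
  also have "\<dots> = (\<Sum>i\<in>UNIV. \<Sum>j\<in>UNIV. (v $ i * cnj (v $ j)) *\<^sub>C (adj (?c * A $ j) * (?c * A $ i)))"
    unfolding sum_product by (subst sum.swap) (simp add: mult_scaleC_left mult_scaleC_right scaleC_scaleC mult.commute)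
  finally have "\<phi> (adj (?c * pencil A v) * (?c * pencil A v)) =
      (\<Sum>i\<in>UNIV. \<Sum>j\<in>UNIV. v $ i * metric_coeff \<phi> A (\<gamma> t) i j * cnj (v $ j))"
    by (simp add: state_sum[OF \<phi>] state_scaleC[OF \<phi>] metric_coeff_def mult_ac)
  then show ?thesis
    using vector_derivative_at[OF v] by (simp add: path_speed_def)
qed

text \<open>For fixed \<delta> a polynomial replaces the logarithm on an interval that contains the
  spectra along the whole compact path. Its derivative along the path is at most
  \<open>1 + \<delta>\<close> times the speed, and letting \<delta> tend to 0 leaves the constant 1,
  whatever \<epsilon> is.\<close>

lemma smoothed_logdet_le_path_len:
  assumes \<phi>: "faithful_tracial_state (\<phi> :: 'a::cstar_algebra \<Rightarrow> complex)" and \<epsilon>: "\<epsilon> > 0"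
    and \<gamma>: "valid_path \<gamma>" "path_image \<gamma> \<subseteq> proj_resolvent A"
  shows "ennreal \<bar>smoothed_logdet \<phi> \<epsilon> (pencil A (pathfinish \<gamma>)) - smoothed_logdet \<phi> \<epsilon> (pencil A (pathstart \<gamma>))\<bar>
    \<le> path_len \<phi> A \<gamma>"
proof (cases "path_len \<phi> A \<gamma> = \<infinity>")
  case False
  then obtain l where l: "l \<ge> 0" "path_len \<phi> A \<gamma> = ennreal l" by (cases "path_len \<phi> A \<gamma>") auto
  define x where "x t = pencil A (\<gamma> t)" for t
  obtain S where S: "finite S" and cont\<gamma>: "continuous_on {0..1} \<gamma>" and C1: "\<gamma> C1_differentiable_on ({0..1} - S)"
    using \<gamma>(1) unfolding valid_path_def piecewise_C1_differentiable_on_def by blast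
  obtain v where v: "\<And>t. t \<in> {0..1} - S \<Longrightarrow> (\<gamma> has_vector_derivative v t) (at t)"
    and contv: "continuous_on ({0..1} - S) v"
    using C1 unfolding C1_differentiable_on_def by blast
  have inv: "alg_invertible (x t)" if "t \<in> {0..1}" for t
    using subsetD[OF \<gamma>(2), of "\<gamma> t"] that by (auto simp: x_def proj_resolvent_def proj_spectrum_def path_image_def)
  have contx: "continuous_on {0..1} x"
    unfolding x_def[abs_def] by (rule bounded_linear.continuous_on[OF bounded_linear_pencil cont\<gamma>])
  then have "bounded (x ` {0..1})" by (intro compact_imp_bounded compact_continuous_image compact_Icc)
  then obtain R where R: "\<And>t. t \<in> {0..1} \<Longrightarrow> norm (x t) \<le> R" unfolding bounded_iff by blast
  define K where "K = R\<^sup>2"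
  have K: "K \<ge> 0" "\<And>t. t \<in> {0..1} \<Longrightarrow> (norm (x t))\<^sup>2 \<le> K"
    using R by (auto simp: K_def intro!: power_mono)
  let ?L = "\<lambda>t. smoothed_logdet \<phi> \<epsilon> (x t)"
  have bound: "\<bar>?L 1 - ?L 0\<bar> \<le> \<delta> + (1 + \<delta>) * l" if \<delta>: "\<delta> > 0" for \<delta>
  proof -
    obtain p where p: "\<And>s. s \<in> {0..K} \<Longrightarrow> \<bar>poly p s - ln (s + \<epsilon>)\<bar> \<le> \<delta>"
      and p': "\<And>s. s \<in> {0..K} \<Longrightarrow> \<bar>poly (pderiv p) s * s\<bar> \<le> 1 + \<delta>"
      using poly_approx_ln[OF K(1) \<epsilon> \<delta>] by blast
    define \<psi> where "\<psi> t = Re (\<phi> (poly_elem (map_poly of_real p) (adj (x t) * x t))) / 2" for t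
    define \<psi>' where "\<psi>' t = Re (\<phi> (poly_elem (map_poly of_real (pderiv p)) (adj (x t) * x t) *
      (adj (x t) * pencil A (v t))))" for t
    have conth: "continuous_on T (\<lambda>t. poly_elem q (adj (x t) * x t))" if "T \<subseteq> {0..1}" for T q
      using continuous_on_subset[OF contx that] unfolding continuous_on_def
      by (intro ballI tendsto_poly_elem tendsto_mult tendsto_adj) auto
    have "ennreal \<bar>\<psi> 1 / (1 + \<delta>) - \<psi> 0 / (1 + \<delta>)\<bar> \<le> path_len \<phi> A \<gamma>"
      unfolding path_len_def
    proof (rule nn_integral_derivative_bound[OF S, of "\<lambda>t. \<psi> t / (1 + \<delta>)" "\<lambda>t. \<psi>' t / (1 + \<delta>)"])
      show "continuous_on {0..1} (\<lambda>t. \<psi> t / (1 + \<delta>))"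
        unfolding \<psi>_def[abs_def]
        by (intro continuous_intros bounded_linear.continuous_on[OF bounded_linear_state[OF \<phi>]] conth) (use \<delta> in auto)
      have sub: "{0<..<1} - S \<subseteq> {0..1} - S" and sub': "{0<..<1} - S \<subseteq> {0..1}" by auto
      show "continuous_on ({0<..<1} - S) (\<lambda>t. \<psi>' t / (1 + \<delta>))"
        unfolding \<psi>'_def[abs_def]
        by (intro continuous_intros bounded_linear.continuous_on[OF bounded_linear_state[OF \<phi>]]
            bounded_linear.continuous_on[OF bounded_linear_adj] bounded_linear.continuous_on[OF bounded_linear_pencil]
            conth continuous_on_subset[OF contv sub] continuous_on_subset[OF contx sub']) (use \<delta> sub' in auto)
      fix t assume t: "t \<in> {0<..<1} - S"
      then have vt: "(\<gamma> has_vector_derivative v t) (at t)" and t01: "t \<in> {0..1}" using v by auto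
      have "(x has_vector_derivative pencil A (v t)) (at t)"
        unfolding x_def[abs_def] by (rule bounded_linear.has_vector_derivative[OF bounded_linear_pencil vt])
      then have "(\<psi> has_vector_derivative \<psi>' t) (at t)"
        unfolding \<psi>_def[abs_def] \<psi>'_def by (rule state_poly_elem_adj_mult_derivative[OF \<phi>])
      then show "((\<lambda>t. \<psi> t / (1 + \<delta>)) has_vector_derivative \<psi>' t / (1 + \<delta>)) (at t)"
        by (rule bounded_linear.has_vector_derivative[OF bounded_linear_divide])
      have "\<bar>\<psi>' t\<bar> \<le> (1 + \<delta>) * path_speed \<phi> A \<gamma> t"
        unfolding \<psi>'_def path_speed_eq[OF \<phi> vt] x_def[symmetric]
        by (rule state_derivative_bound[OF \<phi> inv[OF t01] K(2)[OF t01] p'])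
      then show "\<bar>\<psi>' t / (1 + \<delta>)\<bar> \<le> path_speed \<phi> A \<gamma> t"
        using \<delta> by (simp add: abs_divide divide_le_eq mult.commute)
    qed
    then have "\<bar>\<psi> 1 / (1 + \<delta>) - \<psi> 0 / (1 + \<delta>)\<bar> \<le> l" using l by simp
    then have "\<bar>\<psi> 1 - \<psi> 0\<bar> \<le> (1 + \<delta>) * l"
      using \<delta> by (simp add: abs_divide divide_le_eq mult.commute flip: diff_divide_distrib)
    moreover have "\<bar>?L t - \<psi> t\<bar> \<le> \<delta> / 2" if "t \<in> {0..1}" for t
      unfolding \<psi>_def by (rule smoothed_logdet_approx[OF \<phi> \<epsilon> K(2)[OF that] p])
    from this[of 0] this[of 1] have "\<bar>?L 0 - \<psi> 0\<bar> \<le> \<delta> / 2" "\<bar>?L 1 - \<psi> 1\<bar> \<le> \<delta> / 2" by auto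
    ultimately show ?thesis by linarith
  qed
  have "\<bar>?L 1 - ?L 0\<bar> \<le> l"
  proof (rule field_le_epsilon)
    fix e :: real assume e: "e > 0"
    \<comment> \<open>With \<delta> equal to \<open>e / (1 + l)\<close> the bound
      \<open>\<delta> + (1 + \<delta>) * l\<close> is exactly \<open>l + e\<close>.\<close>
    have "e / (1 + l) + (1 + e / (1 + l)) * l = l + e / (1 + l) * (1 + l)"
      by (simp only: distrib_left distrib_right mult_1 mult_1_right ac_simps)
    also have "\<dots> = l + e" using l by simp
    finally have "e / (1 + l) + (1 + e / (1 + l)) * l = l + e" .
    then show "\<bar>?L 1 - ?L 0\<bar> \<le> l + e" using bound[of "e / (1 + l)"] e l by simp
  qed
  then show ?thesis using l by (simp add: x_def pathstart_def pathfinish_def)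
qed simp

text \<open>Fatou's lemma along \<epsilon> tending to 0, applied to
  \<open>U - ln (t\<^sup>2 + \<epsilon>)\<close>. The constant \<open>U\<close> makes these
  functions nonnegative, and the lower bound \<open>C\<close> keeps their integrals below
  \<open>U - 2 * C\<close>.\<close>

lemma log_integral_not_minus_infinity:
  assumes \<phi>: "faithful_tracial_state (\<phi> :: 'a::cstar_algebra \<Rightarrow> complex)"
    and C: "\<And>\<epsilon>. \<epsilon> > 0 \<Longrightarrow> C \<le> smoothed_logdet \<phi> \<epsilon> x"
  shows "log_integral \<phi> (alg_abs x) \<noteq> -\<infinity>"
proof -
  let ?M = "spectral_distribution \<phi> (alg_abs x)"
  interpret real_distribution ?M by (rule real_distribution_alg_abs[OF \<phi>])
  define R where "R = max 1 (norm x)"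
  \<comment> \<open>The summand 1 covers all \<open>\<epsilon> n\<close>. With \<open>R\<close> at
    least 1 also \<open>ln t\<close> is at most \<open>U\<close>, so
    \<open>U - ln (t\<^sup>2)\<close> dominates \<open>- ln t\<close>.\<close>
  define U where "U = ln (R\<^sup>2 + 1)"
  have R: "R \<ge> 1" by (simp add: R_def)
  define \<epsilon> where "\<epsilon> n = inverse (real (Suc n))" for n
  have \<epsilon>: "\<epsilon> n > 0" "\<epsilon> n \<le> 1" for n
    unfolding \<epsilon>_def by (simp_all add: inverse_le_1_iff)
  have \<epsilon>0: "\<epsilon> \<longlonglongrightarrow> 0"
    unfolding \<epsilon>_def[abs_def] by (rule LIMSEQ_inverse_real_of_nat)
  define g where "g n t = U - ln (t\<^sup>2 + \<epsilon> n)" for n and t :: real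
  have AE: "AE t in ?M. t \<in> {0..R}"
    using AE_spectral_distribution_alg_abs[OF \<phi>, of x] by eventually_elim (auto simp: R_def le_max_iff_disj)
  have g_int: "integrable ?M (g n)" for n
    unfolding g_def[abs_def] using integrable_ln_alg_abs[OF \<phi> \<epsilon>(1)] by simp
  have g0: "AE t in ?M. 0 \<le> g n t" for n
    using AE
  proof eventually_elim
    case (elim t)
    then have "t\<^sup>2 \<le> R\<^sup>2" by (intro power_mono) auto
    then show ?case using \<epsilon>[of n] by (simp add: g_def U_def add_nonneg_pos add_mono)
  qed
  have g_le: "(\<integral>\<^sup>+t. ennreal (g n t) \<partial>?M) \<le> ennreal (U - 2 * C)" for n
  proof -
    have "(LINT t|?M. g n t) = U - 2 * smoothed_logdet \<phi> (\<epsilon> n) x"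
      unfolding g_def[abs_def] using integrable_ln_alg_abs[OF \<phi> \<epsilon>(1)] prob_space
      by (simp add: smoothed_logdet_def)
    then show ?thesis
      using C[OF \<epsilon>(1)[of n]] by (subst nn_integral_eq_integral[OF g_int g0]) (auto intro!: ennreal_leI)
  qed
  have lim: "AE t in ?M. e2ennreal (- elog t) \<le> liminf (\<lambda>n. ennreal (g n t))"
    using AE
  proof eventually_elim
    case (elim t)
    show ?case
    proof (cases "t = 0")
      case True
      \<comment> \<open>An atom at 0 is where \<open>- elog t\<close> is infinite; the smoothed
        integrands diverge there as well.\<close>
      have "filterlim (\<lambda>n. g n t) at_top sequentially"
      proof -
        have "filterlim (\<lambda>n. ln (real (Suc n))) at_top sequentially"
          by (rule filterlim_compose[OF ln_at_top])
            (rule filterlim_compose[OF filterlim_real_sequentially filterlim_Suc])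
        then have "filterlim (\<lambda>n. U + ln (real (Suc n))) at_top sequentially"
          by (rule filterlim_tendsto_add_at_top[OF tendsto_const])
        moreover have "g n t = U + ln (real (Suc n))" for n
          unfolding g_def \<epsilon>_def using True by (simp add: ln_inverse del: of_nat_Suc)
        ultimately show ?thesis by simp
      qed
      then have "(\<lambda>n. ennreal (g n t)) \<longlonglongrightarrow> top"
        by (simp only: ennreal_tendsto_top_eq_at_top)
      then have "liminf (\<lambda>n. ennreal (g n t)) = top" by (rule lim_imp_Liminf[rotated]) simp
      then show ?thesis by simp
    next
      case False
      then have t: "t > 0" "t \<le> R" using elim by auto
      have "(\<lambda>n. U - ln (t\<^sup>2 + \<epsilon> n)) \<longlonglongrightarrow> U - ln (t\<^sup>2 + 0)"
        using t by (intro tendsto_intros \<epsilon>0) auto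
      then have "(\<lambda>n. ennreal (g n t)) \<longlonglongrightarrow> ennreal (U - ln (t\<^sup>2))"
        by (intro tendsto_ennrealI) (simp add: g_def)
      then have "liminf (\<lambda>n. ennreal (g n t)) = ennreal (U - ln (t\<^sup>2))" by (rule lim_imp_Liminf[rotated]) simp
      moreover have "- ln t \<le> U - ln (t\<^sup>2)"
      proof -
        have "t * 1 \<le> R * R" using t R by (intro mult_mono) auto
        then have "ln t \<le> U" unfolding U_def using t by (intro ln_mono) (auto simp: power2_eq_square)
        then show ?thesis using t by (simp add: ln_realpow)
      qed
      moreover have "e2ennreal (- elog t) = ennreal (- ln t)"
        using t by (simp add: elog_def e2ennreal_ereal)
      ultimately show ?thesis by (simp add: ennreal_leI)
    qed
  qed
  have "(\<integral>\<^sup>+t\<in>real_spectrum (alg_abs x). e2ennreal (- elog t) \<partial>?M) \<le> (\<integral>\<^sup>+t. liminf (\<lambda>n. ennreal (g n t)) \<partial>?M)"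
    by (rule nn_integral_mono_AE) (use lim in \<open>eventually_elim; auto simp: indicator_def\<close>)
  also have "\<dots> \<le> liminf (\<lambda>n. \<integral>\<^sup>+t. ennreal (g n t) \<partial>?M)"
    by (rule nn_integral_liminf) (use g_int in auto)
  also have "\<dots> \<le> liminf (\<lambda>n::nat. ennreal (U - 2 * C))"
    by (rule Liminf_mono) (simp add: g_le)
  also have "\<dots> = ennreal (U - 2 * C)" by (simp add: Liminf_const)
  finally have "(\<integral>\<^sup>+t\<in>real_spectrum (alg_abs x). e2ennreal (- elog t) \<partial>?M) \<noteq> \<infinity>"
    by (auto simp: top_unique)
  then obtain r where "r \<ge> 0" "(\<integral>\<^sup>+t\<in>real_spectrum (alg_abs x). e2ennreal (- elog t) \<partial>?M) = ennreal r"
    by (cases "\<integral>\<^sup>+t\<in>real_spectrum (alg_abs x). e2ennreal (- elog t) \<partial>?M") auto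
  \<comment> \<open>A finite negative part is enough: subtracting a real number from a nonnegative
    extended real never gives minus infinity.\<close>
  moreover have "0 \<le> enn2ereal z" for z by simp
  ultimately show ?thesis
    unfolding log_integral_def by (cases "enn2ereal (\<integral>\<^sup>+t\<in>real_spectrum (alg_abs x). e2ennreal (elog t) \<partial>?M)") auto
qed

theorem theorem3p2:
  fixes \<phi> :: "'a::cstar_algebra \<Rightarrow> complex"
    and A :: "'a ^ 'n"
    and q :: "complex ^ 'n"
  assumes "faithful_tracial_state \<phi>"
    and "linearly_independent A"
    and "proj_resolvent A \<noteq> {}"
    and "q \<in> frontier (proj_resolvent A)"
    and "phi_singular \<phi> (pencil A q)"
  shows "q \<notin> completion_points \<phi> A"
proof
  note \<phi> = assms(1)
  assume "q \<in> completion_points \<phi> A"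
  then obtain u where u: "\<And>k. u k \<in> proj_resolvent A" "dist_Cauchy \<phi> A u" "u \<longlonglongrightarrow> q"
    by (auto simp: completion_points_def)
  \<comment> \<open>The tolerance 1 is arbitrary; any finite bound on the distance from the fixed
    point \<open>u N\<close> gives a lower bound along the tail, here \<open>C - 1\<close>.\<close>
  obtain N where N: "\<And>k m. k \<ge> N \<Longrightarrow> m \<ge> N \<Longrightarrow> path_dist \<phi> A (u k) (u m) < ennreal 1"
    using u(2) unfolding dist_Cauchy_def by (meson zero_less_one)
  have "alg_invertible (pencil A (u N))"
    using u(1)[of N] by (simp add: proj_resolvent_def proj_spectrum_def)
  then obtain C where C: "\<And>\<epsilon>. \<epsilon> > 0 \<Longrightarrow> C \<le> smoothed_logdet \<phi> \<epsilon> (pencil A (u N))"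
    using smoothed_logdet_lower_bound[OF \<phi>] by blast
  have "C - 1 \<le> smoothed_logdet \<phi> \<epsilon> (pencil A q)" if \<epsilon>: "\<epsilon> > 0" for \<epsilon>
  proof (rule tendsto_lowerbound)
    show "(\<lambda>k. smoothed_logdet \<phi> \<epsilon> (pencil A (u k))) \<longlonglongrightarrow> smoothed_logdet \<phi> \<epsilon> (pencil A q)"
      by (intro tendsto_smoothed_logdet[OF \<phi> \<epsilon>] bounded_linear.tendsto[OF bounded_linear_pencil] u(3))
    have "C - 1 \<le> smoothed_logdet \<phi> \<epsilon> (pencil A (u k))" if k: "k \<ge> N" for k
    proof -
      obtain \<gamma> where \<gamma>: "valid_path \<gamma>" "path_image \<gamma> \<subseteq> proj_resolvent A"
        "pathstart \<gamma> = u N" "pathfinish \<gamma> = u k" "path_len \<phi> A \<gamma> < 1"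
        using N[OF order.refl k] unfolding path_dist_def INF_less_iff by auto
      have "ennreal \<bar>smoothed_logdet \<phi> \<epsilon> (pencil A (u k)) - smoothed_logdet \<phi> \<epsilon> (pencil A (u N))\<bar> < 1"
        using smoothed_logdet_le_path_len[OF \<phi> \<epsilon> \<gamma>(1,2), unfolded \<gamma>(3,4)] \<gamma>(5) by (rule le_less_trans)
      then show ?thesis using C[OF \<epsilon>] by (simp add: ennreal_less_one_iff)
    qed
    then show "\<forall>\<^sub>F k in sequentially. C - 1 \<le> smoothed_logdet \<phi> \<epsilon> (pencil A (u k))"
      unfolding eventually_sequentially by blast
  qed simp
  then have "log_integral \<phi> (alg_abs (pencil A q)) \<noteq> -\<infinity>"
    by (rule log_integral_not_minus_infinity[OF \<phi>])
  \<comment> \<open>The exponential is never 0, so a vanishing determinant can come only from a log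
    integral equal to minus infinity.\<close>
  then show False
    using assms(5) by (simp add: phi_singular_def fk_det_def)
qed

end
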